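(* Let $0<\alpha<1$, $\xi>0$, and let $X\subset\mathbb{R}^d$ with $|X|=n$ and a stationary point $C^*$ (with $k$ centroids) be such that $(X,C^* )$ is $f(\alpha)$-clusterable, where in addition $$f(\alpha)\ge 5\sqrt{\frac{1}{2w_{\min}}\ln\Big(\frac{2}{\xi p^*_{\min}}\ln\frac{2k}{\xi}\Big)}.$$ Fix $\beta\ge2$ and $0<\delta<\frac1e$. Initialize the stochastic $k$-means algorithm with $C^0$ produced by Buckshot seeding with $m_o$ satisfying $$\frac{\log\frac{2k}{\xi}}{p^*_{\min}}<m_o<\frac{\xi}{2}\exp\Big\{2\Big(\frac{f(\alpha)}{4}-1\Big)^2w_{\min}^2\Big\},$$ and run it with learning rate $\eta^t_r=\eta^t=\frac{c'}{t+t_o}$ for all $r\in[k]$ and mini-batch size $m$ so that $$m>\frac{\ln(1-\sqrt\alpha)}{\ln(1-\frac45p^*_{\min})},$$ $$c'>\frac{\beta}{2[1-\sqrt\alpha-e^{-\frac45mp^*_{\min}}]},\qquad t_o\ge 867(c')^2n^2\ln^2\frac1\delta .$$ Then for every $t\ge1$ there exists an event $G_t\subset\Omega$, where $\Omega$ is the sample space of the algorithm (including its seeding), such that $$\Pr\{G_t\}\ge(1-\delta)(1-\xi)\quad\text{and}\quad E[\phi^t\mid G_t]-\phi^*\le E[\Delta(C^t,C^* )\mid G_t]=O\Big(\frac1t\Big),$$ where $\phi^t=\phi(C^t)$ and $\phi^*=\phi(C^* )$.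
   Context: **$k$-means.** $X\subset\mathbb{R}^d$ is a finite dataset with $|X|=n$, and $[k]=\{1,\dots,k\}$. For $C=\{c_1,\dots,c_k\}\subset\mathbb{R}^d$, $\phi(C)=\sum_{x\in X}\min_r\|x-c_r\|^2$. $V(C)\cap X$ is the set of all clusterings $A=\{A_r\}$ of $X$ obtained by assigning each point to one of its closest centroids; if it is unique it is denoted $v(C)$. $m(A)$ is the set of means of the clusters of $A$. $C^*$ is a stationary point if $C^*=m(A^* )$ for a clustering $A^*\in V(C^* )\cap X$ (so $A^*=v(C^* )$ when unique). Write $n_r^*=|A_r^*|$, $\phi^*=\phi(C^* )$, $\phi_r^*=\sum_{x\in A_r^*}\|x-c_r^*\|^2$. **Margin.** For $A\in V(C)\cap X$, $r\neq s$, $x\in A_r\cup A_s$, let $\bar x$ be the projection of $x$ onto the line through $c_r,c_s$, and $\Delta_{rs}(C)=\min_{x\in A_r\cup A_s}\big|\|\bar x-c_r\|-\|\bar x-c_s\|\big|$. $C$ has a $\gamma$-margin (with respect to $X$) if for some $A\in V(C)\cap X$, $\min_{r,\,s\ne r}\Delta_{rs}(C)=\gamma$. **$f(\alpha)$-clusterability.** For $\alpha\in(0,1)$, $(X,C^* )$ is $f(\alpha)$-clusterable if $C^*$ is a stationary point having a $\gamma$-margin with, for all $r\ne s$, $\gamma\ge f(\alpha)\sqrt{\phi^*}\big(\frac1{\sqrt{n_r^*}}+\frac1{\sqrt{n_s^*}}\big)$, where $f(\alpha)>\max\{64^2,\frac{5\alpha+5}{256\alpha},\max_{r\neq s}\frac{n_r^*}{n_s^*}\}$.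 **Constants.** $p^*_{\min}=\min_r n_r^*/n$; $w_r=\frac{\phi_r^*/n_r^*}{\max_{x\in A_r^*}\|x-c_r^*\|^2}$, $w_{\min}=\min_r w_r$. **Centroidal distance.** $\Delta(C,C^* )=\min_\pi\sum_r n_r^*\|c_{\pi(r)}-c_r^*\|^2$ over permutations $\pi$ of $[k]$. **Buckshot seeding.** Sample $m_o$ points from $X$ uniformly at random with replacement; run Single-Linkage on them until there are only $k$ connected components left; $C^0$ is the set of means of the $k$ components. **Stochastic $k$-means algorithm.** At iteration $t\ge1$: draw a sample $S^t$ of $m$ points of $X$ uniformly at random with replacement; assign each $s\in S^t$ to a closest centroid in $C^{t-1}$, giving sub-samples $S^t_r$; for each $r$ with $S_r^t\ne\emptyset$, set $c_r^t=(1-\eta_r^t)c_r^{t-1}+\eta_r^t\hat c_r^t$ with $\hat c_r^t$ the mean of $S_r^t$; for other $r$, $c_r^t=c_r^{t-1}$. $O(1/t)$ means bounded by a constant times $1/t$, the constant not depending on $t$.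
   Formalization: Adds the assumption that the bracket 1 − √α − exp(−(4/5) m p*_min) in the lower bound for c' is positive; the stated condition on m does not imply this, and without it c' may be 0 or too small and the O(1/t) claim fails. *)

theory Defs
  imports "HOL-Probability.Probability" "HOL-Combinatorics.Permutations"
begin

text \<open>
  A system of \<open>k\<close> centroids is a function \<open>C\<close> on indices, of which only the values on
  \<open>{1..k}\<close> matter; likewise a clustering is an indexed family \<open>A\<close> of sets.
\<close>

definition is_closest :: "nat \<Rightarrow> (nat \<Rightarrow> 'a::euclidean_space) \<Rightarrow> 'a \<Rightarrow> nat \<Rightarrow> bool" where
  "is_closest k C x r \<longleftrightarrow> r \<in> {1..k} \<and> (\<forall>s\<in>{1..k}. norm (x - C r) \<le> norm (x - C s))"

definition cost :: "'a::euclidean_space set \<Rightarrow> nat \<Rightarrow> (nat \<Rightarrow> 'a) \<Rightarrow> real" where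
  "cost X k C = (\<Sum>x\<in>X. MIN r\<in>{1..k}. (norm (x - C r))\<^sup>2)"

text \<open>The set \<open>V(C) \<inter> X\<close>: one clustering for every way of breaking ties.\<close>

definition voronoi_clusterings ::
    "'a::euclidean_space set \<Rightarrow> nat \<Rightarrow> (nat \<Rightarrow> 'a) \<Rightarrow> (nat \<Rightarrow> 'a set) set" where
  "voronoi_clusterings X k C =
     {A. \<exists>a. (\<forall>x\<in>X. is_closest k C x (a x)) \<and> A = (\<lambda>r. {x\<in>X. a x = r})}"

text \<open>
  The mean of an indexed family of points. A cluster \<open>A\<close> has mean \<open>mean_of A (\<lambda>x. x)\<close>; samples drawn
  with replacement are indexed by their position, so that repeated points count with multiplicity.
\<close>

definition mean_of :: "'i set \<Rightarrow> ('i \<Rightarrow> 'a::euclidean_space) \<Rightarrow> 'a" where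
  "mean_of J z = (\<Sum>j\<in>J. z j) /\<^sub>R real (card J)"

definition stationary_point ::
    "'a::euclidean_space set \<Rightarrow> nat \<Rightarrow> (nat \<Rightarrow> 'a) \<Rightarrow> (nat \<Rightarrow> 'a set) \<Rightarrow> bool" where
  "stationary_point X k C A \<longleftrightarrow> A \<in> voronoi_clusterings X k C \<and>
     (\<forall>r\<in>{1..k}. A r \<noteq> {} \<and> C r = mean_of (A r) (\<lambda>x. x))"

definition margin_between ::
    "(nat \<Rightarrow> 'a::euclidean_space) \<Rightarrow> (nat \<Rightarrow> 'a set) \<Rightarrow> nat \<Rightarrow> nat \<Rightarrow> real" where
  "margin_between C A r s =
     (MIN x \<in> A r \<union> A s.
        let xp = closest_point (affine hull {C r, C s}) x
        in \<bar>norm (xp - C r) - norm (xp - C s)\<bar>)"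

definition has_margin :: "'a::euclidean_space set \<Rightarrow> nat \<Rightarrow> (nat \<Rightarrow> 'a) \<Rightarrow> real \<Rightarrow> bool" where
  "has_margin X k C \<gamma> \<longleftrightarrow> (\<exists>A \<in> voronoi_clusterings X k C.
     \<gamma> = Min {margin_between C A r s | r s. r \<in> {1..k} \<and> s \<in> {1..k} \<and> r \<noteq> s})"

definition clusterable ::
    "(real \<Rightarrow> real) \<Rightarrow> real \<Rightarrow> 'a::euclidean_space set \<Rightarrow> nat \<Rightarrow>
     (nat \<Rightarrow> 'a) \<Rightarrow> (nat \<Rightarrow> 'a set) \<Rightarrow> bool" where
  "clusterable f \<alpha> X k C A \<longleftrightarrow>
     stationary_point X k C A \<and>
     (\<exists>\<gamma>. has_margin X k C \<gamma> \<and>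
        (\<forall>r\<in>{1..k}. \<forall>s\<in>{1..k}. r \<noteq> s \<longrightarrow>
           \<gamma> \<ge> f \<alpha> * sqrt (cost X k C) * (1 / sqrt (card (A r)) + 1 / sqrt (card (A s))))) \<and>
     f \<alpha> > 64\<^sup>2 \<and>
     f \<alpha> > (5 * \<alpha> + 5) / (256 * \<alpha>) \<and>
     (\<forall>r\<in>{1..k}. \<forall>s\<in>{1..k}. r \<noteq> s \<longrightarrow> f \<alpha> > real (card (A r)) / real (card (A s)))"

definition p_min :: "'a set \<Rightarrow> nat \<Rightarrow> (nat \<Rightarrow> 'a set) \<Rightarrow> real" where
  "p_min X k A = (MIN r\<in>{1..k}. real (card (A r)) / real (card X))"

definition cluster_cost :: "(nat \<Rightarrow> 'a::euclidean_space) \<Rightarrow> (nat \<Rightarrow> 'a set) \<Rightarrow> nat \<Rightarrow> real" where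
  "cluster_cost C A r = (\<Sum>x\<in>A r. (norm (x - C r))\<^sup>2)"

text \<open>
  For a cluster consisting of its centroid only, the quotient is the undefined expression 0/0.
  It evaluates to 0, and then no \<open>m\<^sub>o\<close> satisfies \<open>ln (2 k / \<xi>) / p\<^sub>m\<^sub>i\<^sub>n < m\<^sub>o < (\<xi> / 2) exp 0\<close>
  for \<open>\<xi> < 1\<close>.
\<close>

definition w_coeff :: "(nat \<Rightarrow> 'a::euclidean_space) \<Rightarrow> (nat \<Rightarrow> 'a set) \<Rightarrow> nat \<Rightarrow> real" where
  "w_coeff C A r =
     (cluster_cost C A r / real (card (A r))) / (MAX x\<in>A r. (norm (x - C r))\<^sup>2)"

definition w_min :: "nat \<Rightarrow> (nat \<Rightarrow> 'a::euclidean_space) \<Rightarrow> (nat \<Rightarrow> 'a set) \<Rightarrow> real" where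
  "w_min k C A = (MIN r\<in>{1..k}. w_coeff C A r)"

text \<open>The weights \<open>n\<^sub>r\<^sup>*\<close> are the cluster sizes of the clustering \<open>A\<close> belonging to \<open>C'\<close>.\<close>

definition centroidal_dist ::
    "nat \<Rightarrow> (nat \<Rightarrow> 'a set) \<Rightarrow> (nat \<Rightarrow> 'a::euclidean_space) \<Rightarrow> (nat \<Rightarrow> 'a) \<Rightarrow> real" where
  "centroidal_dist k A C C' =
     (MIN \<pi>\<in>{\<pi>. \<pi> permutes {1..k}}. \<Sum>r\<in>{1..k}. real (card (A r)) * (norm (C (\<pi> r) - C' r))\<^sup>2)"

text \<open>
  Single-Linkage on the points \<open>z j\<close>, \<open>j \<in> J\<close>: the partitions of \<open>J\<close> that can be reached from the
  singletons by merging two components at minimal distance, ties being broken arbitrarily.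
\<close>

definition linkage_dist :: "('i \<Rightarrow> 'a::euclidean_space) \<Rightarrow> 'i set \<Rightarrow> 'i set \<Rightarrow> real" where
  "linkage_dist z P Q = Min {norm (z i - z j) | i j. i \<in> P \<and> j \<in> Q}"

inductive single_linkage :: "('i \<Rightarrow> 'a::euclidean_space) \<Rightarrow> 'i set \<Rightarrow> 'i set set \<Rightarrow> bool"
  for z J where
  start: "single_linkage z J ((\<lambda>j. {j}) ` J)"
| merge: "single_linkage z J \<P> \<Longrightarrow> P \<in> \<P> \<Longrightarrow> Q \<in> \<P> \<Longrightarrow> P \<noteq> Q \<Longrightarrow>
    (\<forall>P'\<in>\<P>. \<forall>Q'\<in>\<P>. P' \<noteq> Q' \<longrightarrow> linkage_dist z P Q \<le> linkage_dist z P' Q') \<Longrightarrow>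
    single_linkage z J (insert (P \<union> Q) (\<P> - {P, Q}))"

text \<open>The bijection \<open>comp\<close> numbers the components in an arbitrary order.\<close>

definition buckshot ::
    "nat \<Rightarrow> nat \<Rightarrow> (nat \<Rightarrow> 'a::euclidean_space) \<Rightarrow> (nat \<Rightarrow> 'a) \<Rightarrow> bool" where
  "buckshot k m\<^sub>o z C0 \<longleftrightarrow> (\<exists>\<P> comp. single_linkage z {..<m\<^sub>o} \<P> \<and> card \<P> = k \<and>
     bij_betw comp {1..k} \<P> \<and> (\<forall>r\<in>{1..k}. C0 r = mean_of (comp r) z))"

definition kmeans_step ::
    "nat \<Rightarrow> nat \<Rightarrow> (nat \<Rightarrow> real) \<Rightarrow> (nat \<Rightarrow> 'a::euclidean_space) \<Rightarrow> (nat \<Rightarrow> 'a) \<Rightarrow> (nat \<Rightarrow> 'a) \<Rightarrow> bool"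
  where
  "kmeans_step k m \<eta> C S C' \<longleftrightarrow> (\<exists>a. (\<forall>j<m. is_closest k C (S j) (a j)) \<and>
     (\<forall>r\<in>{1..k}. C' r =
        (let J = {j. j < m \<and> a j = r} in
         if J = {} then C r else (1 - \<eta> r) *\<^sub>R C r + \<eta> r *\<^sub>R mean_of J S)))"

text \<open>
  A sample point is a pair of the \<open>m\<^sub>o\<close> points drawn for the seeding and the sequence of
  mini-batches; all draws are independent and uniform on \<open>X\<close>.
\<close>

type_synonym 'a sample = "(nat \<Rightarrow> 'a) \<times> (nat \<Rightarrow> nat \<Rightarrow> 'a)"

definition sample_space :: "'a set \<Rightarrow> nat \<Rightarrow> nat \<Rightarrow> 'a sample measure" where
  "sample_space X m\<^sub>o m =
     (\<Pi>\<^sub>M i\<in>{..<m\<^sub>o}. uniform_count_measure X) \<Otimes>\<^sub>M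
     (\<Pi>\<^sub>M t\<in>{1..}. \<Pi>\<^sub>M j\<in>{..<m}. uniform_count_measure X)"

text \<open>
  \<open>C t \<omega>\<close> is the system of centroids after iteration \<open>t\<close>. Ties in the seeding and in the assignment
  steps may be broken by any measurable rule. Every such process takes only finitely many values at
  each time, so all expectations below exist.
\<close>

definition stochastic_kmeans ::
    "'a::euclidean_space set \<Rightarrow> nat \<Rightarrow> nat \<Rightarrow> nat \<Rightarrow> (nat \<Rightarrow> nat \<Rightarrow> real) \<Rightarrow>
     (nat \<Rightarrow> 'a sample \<Rightarrow> nat \<Rightarrow> 'a) \<Rightarrow> bool" where
  "stochastic_kmeans X k m\<^sub>o m \<eta> C \<longleftrightarrow>
     (\<forall>t. \<forall>r\<in>{1..k}. (\<lambda>\<omega>. C t \<omega> r) \<in> borel_measurable (sample_space X m\<^sub>o m)) \<and>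
     (\<forall>\<omega>\<in>space (sample_space X m\<^sub>o m).
        buckshot k m\<^sub>o (fst \<omega>) (C 0 \<omega>) \<and>
        (\<forall>t\<ge>1. kmeans_step k m (\<eta> t) (C (t - 1) \<omega>) (snd \<omega> t) (C t \<omega>)))"

definition expectation_given :: "'b measure \<Rightarrow> ('b \<Rightarrow> real) \<Rightarrow> 'b set \<Rightarrow> real" where
  "expectation_given M Y G = (LINT \<omega>:G|M. Y \<omega>) / measure M G"

end

theory Submission
  imports Defs
begin

text \<open>
  The lower bound on \<open>f \<alpha>\<close> involving \<open>w\<^sub>m\<^sub>i\<^sub>n\<close> turns the margin into a separation of the clusters by
  more than their diameter, which makes the dynamics essentially deterministic: once every cluster
  has been hit by the seeding sample, Single-Linkage returns exactly the traces of the clusters on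
  the sample, and since the learning rates are at most 1 each centroid stays in the convex hull of
  its cluster, where every point of the cluster is assigned to it. So on the event \<open>G\<close> that the
  seeding hits all clusters, which does not depend on \<open>t\<close> and has probability at least
  \<open>1 - \<xi>/2\<close>, each centroid performs a stochastic approximation of its own cluster mean: with
  \<open>b\<^sub>t\<close> the mean squared distance and \<open>q\<close> the probability that a batch meets the cluster,
  \<open>b\<^sub>t \<le> (1 - 2 \<eta>\<^sup>t q) b\<^sub>t\<^sub>-\<^sub>1 + 2 (\<eta>\<^sup>t)\<^sup>2 M\<^sup>2\<close>, and \<open>c' q \<ge> 1\<close> gives \<open>b\<^sub>t = O(1/t)\<close>.
\<close>

section \<open>Separated clusterings\<close>

text \<open>The process \<open>C\<close> is only assumed measurable: ties may be broken in any way
  and the seeding components are numbered arbitrarily, so its law is not explicit. Strict separation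
  removes this freedom. On \<open>seeding_hits\<close>, each sample point has one permutation, valid
  for all times, under which every centroid equals \<open>cluster_path\<close>, an explicit function
  of the seeding points and the batches that ignores the other clusters.
  \<open>centroidal_dist\<close> is a minimum over permutations, so any permutation gives an upper
  bound; the resulting bound no longer contains it, and its measurability never becomes an issue. As
  the event depends on the seeding only, conditioning leaves the batches iid: for a fixed seeding
  the clusters are integrated one by one over the batches, with a bound uniform in the seeding. The
  rate 1/t survives because a contraction by 1 - 2/\<tau> with noise K/\<tau>^2 preserves the bound
  K/\<tau> when \<tau> grows by 1.\<close>

lemma
  assumes "finite P" "finite Q"
  shows linkage_dist_le: "i \<in> P \<Longrightarrow> j \<in> Q \<Longrightarrow> linkage_dist z P Q \<le> norm (z i - z j)"
    and linkage_dist_attained: "P \<noteq> {} \<Longrightarrow> Q \<noteq> {} \<Longrightarrow>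
      \<exists>i\<in>P. \<exists>j\<in>Q. linkage_dist z P Q = norm (z i - z j)"
proof -
  have eq: "linkage_dist z P Q = Min ((\<lambda>(i, j). norm (z i - z j)) ` (P \<times> Q))"
    unfolding linkage_dist_def by (rule arg_cong[where f = Min]) auto
  have fin: "finite ((\<lambda>(i, j). norm (z i - z j)) ` (P \<times> Q))" using assms by simp
  show "linkage_dist z P Q \<le> norm (z i - z j)" if "i \<in> P" "j \<in> Q"
    unfolding eq using that by (intro Min_le[OF fin]) force
  show "\<exists>i\<in>P. \<exists>j\<in>Q. linkage_dist z P Q = norm (z i - z j)" if "P \<noteq> {}" "Q \<noteq> {}"
    using Min_in[OF fin] that unfolding eq by force
qed

text \<open>The same \<open>\<rho>\<close> bounds the diameters and lies strictly below the gaps.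
  \<open>far\<close> has a convex hull on one side because sample points are compared with
  centroids, which stay in the hulls; comparing two sample points, as Single-Linkage does, is a
  special case.\<close>

locale separated_clustering =
  fixes X :: "'a::euclidean_space set" and k :: nat and A :: "nat \<Rightarrow> 'a set" and \<rho> :: real
  assumes finite_X: "finite X"
    and cover: "X = (\<Union>r\<in>{1..k}. A r)"
    and nonempty: "r \<in> {1..k} \<Longrightarrow> A r \<noteq> {}"
    and near: "r \<in> {1..k} \<Longrightarrow> x \<in> A r \<Longrightarrow> y \<in> A r \<Longrightarrow> dist x y \<le> \<rho>"
    and far: "r \<in> {1..k} \<Longrightarrow> s \<in> {1..k} \<Longrightarrow> r \<noteq> s \<Longrightarrow> x \<in> A r \<Longrightarrow> y \<in> convex hull (A s) \<Longrightarrow>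
      \<rho> < dist x y"
begin

lemma cluster_unique:
  assumes "r \<in> {1..k}" "s \<in> {1..k}" "x \<in> A r" "x \<in> A s"
  shows "r = s"
  using near[OF assms(1,3,3)] far[OF assms(1,2) _ assms(3) hull_inc[OF assms(4)]] by force

lemma near_hull:
  assumes "r \<in> {1..k}" "x \<in> A r" "c \<in> convex hull (A r)"
  shows "dist x c \<le> \<rho>"
proof -
  have "convex hull (A r) \<subseteq> cball x \<rho>"
    using near assms by (intro hull_minimal) auto
  then show ?thesis using assms(3) by auto
qed

text \<open>The inequalities are strict, so there are no ties and every admissible tie-breaking rule
  yields the same assignment. \<open>\<pi>\<close> accounts for the arbitrary numbering of the
  centroids.\<close>

lemma is_closest_iff:
  assumes \<pi>: "\<pi> permutes {1..k}"
    and C: "\<And>s. s \<in> {1..k} \<Longrightarrow> C (\<pi> s) \<in> convex hull (A s)"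
    and r: "r \<in> {1..k}" and x: "x \<in> A r"
  shows "is_closest k C x i \<longleftrightarrow> i = \<pi> r"
proof -
  have less: "norm (x - C (\<pi> r)) < norm (x - C j)" if "j \<in> {1..k}" "j \<noteq> \<pi> r" for j
  proof -
    obtain s where s: "s \<in> {1..k}" "j = \<pi> s"
      using permutes_image[OF \<pi>] \<open>j \<in> {1..k}\<close> by blast
    have "\<rho> < dist x (C j)"
      using far[OF r s(1) _ x C[OF s(1)]] s(2) that(2) by auto
    then show ?thesis using near_hull[OF r x C[OF r]] by (simp add: dist_norm)
  qed
  have "\<pi> r \<in> {1..k}" using permutes_in_image[OF \<pi>] r by blast
  then show ?thesis
    unfolding is_closest_def using less by (smt (verit))
qed

definition refines_clusters :: "('i \<Rightarrow> 'a) \<Rightarrow> 'i set set \<Rightarrow> bool" where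
  "refines_clusters z \<P> \<longleftrightarrow> (\<forall>P\<in>\<P>. \<exists>r\<in>{1..k}. z ` P \<subseteq> A r)"

text \<open>Each component lies in one cluster \<open>h P\<close>, and \<open>h\<close> is onto
  because every cluster is hit; so there are at least \<open>k\<close> components. The map itself is
  returned since it serves both the pigeonhole argument above \<open>k\<close> components and the
  identification at exactly \<open>k\<close>.\<close>

lemma refines_card_ge:
  assumes part: "partition_on J \<P>" and fin: "finite J" and ref: "refines_clusters z \<P>"
    and hit: "\<And>r. r \<in> {1..k} \<Longrightarrow> \<exists>j\<in>J. z j \<in> A r"
  obtains h where "h ` \<P> = {1..k}" "\<And>P. P \<in> \<P> \<Longrightarrow> z ` P \<subseteq> A (h P)"
proof -
  obtain h where h: "\<And>P. P \<in> \<P> \<Longrightarrow> h P \<in> {1..k} \<and> z ` P \<subseteq> A (h P)"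
    using ref unfolding refines_clusters_def by metis
  have "r \<in> h ` \<P>" if r: "r \<in> {1..k}" for r
  proof -
    obtain j P where "j \<in> J" "z j \<in> A r" "P \<in> \<P>" "j \<in> P"
      using hit[OF r] partition_onD1[OF part] by blast
    then show ?thesis using h[of P] cluster_unique[OF r] by blast
  qed
  with h that show ?thesis by blast
qed

text \<open>Pigeonhole: more than \<open>k\<close> components inside \<open>k\<close> clusters put
  two of them into one cluster, at distance at most \<open>\<rho>\<close>, so the closest pair
  cannot straddle two clusters. Once \<open>k\<close> components are reached, the next merge falls
  below \<open>k\<close>, and the disjunct \<open>card \<P> < k\<close> absorbs all later
  stages.\<close>

lemma single_linkage_invariant:
  assumes "single_linkage z J \<P>" and fin: "finite J" and z: "\<And>j. j \<in> J \<Longrightarrow> z j \<in> X"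
    and hit: "\<And>r. r \<in> {1..k} \<Longrightarrow> \<exists>j\<in>J. z j \<in> A r"
  shows "partition_on J \<P> \<and> (card \<P> < k \<or> refines_clusters z \<P>)"
  using assms(1)
proof induction
  case start
  have "refines_clusters z ((\<lambda>j. {j}) ` J)"
    unfolding refines_clusters_def using z cover by auto
  then show ?case using partition_on_singletons by blast
next
  case (merge \<P> P Q)
  note PQ = merge.hyps(2-4)
  from merge.IH have part: "partition_on J \<P>" by blast
  have finP: "finite \<P>" using finite_elements[OF fin part] .
  have finpart: "finite R" "R \<noteq> {}" if "R \<in> \<P>" for R
    using that partition_onD1[OF part] partition_onD3[OF part] fin
    by (auto intro: finite_subset[of R J])
  have disj: "R \<inter> S = {}" if "R \<in> \<P>" "S \<in> \<P>" "R \<noteq> S" for R S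
    using partition_onD2[OF part] that by (simp add: disjointD)
  have part': "partition_on J (insert (P \<union> Q) (\<P> - {P, Q}))"
  proof (rule partition_onI)
    show "\<Union> (insert (P \<union> Q) (\<P> - {P, Q})) = J"
      using PQ(1,2) partition_onD1[OF part] by blast
    show "{} \<notin> insert (P \<union> Q) (\<P> - {P, Q})"
      using finpart PQ(1) by blast
    show "disjnt R S" if "R \<in> insert (P \<union> Q) (\<P> - {P, Q})"
      "S \<in> insert (P \<union> Q) (\<P> - {P, Q})" "R \<noteq> S" for R S
      using that disj PQ(1,2) unfolding disjnt_def by blast
  qed
  have "card (insert (P \<union> Q) (\<P> - {P, Q})) \<le> Suc (card (\<P> - {P, Q}))"
    using finP by (simp add: card_insert_if)
  also have "Suc (card (\<P> - {P, Q})) = card \<P> - 1"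
    using PQ finP card_mono[OF finP, of "{P, Q}"] by (simp add: card_Diff_subset)
  finally have card': "card (insert (P \<union> Q) (\<P> - {P, Q})) \<le> card \<P> - 1" .
  have pos: "card \<P> > 0" using PQ finP card_gt_0_iff by blast
  show ?case
  proof (cases "card \<P> \<le> k")
    case True
    then show ?thesis using part' card' pos by linarith
  next
    case False
    then have ref: "refines_clusters z \<P>" using merge.IH by linarith
    obtain h where h: "h ` \<P> = {1..k}" "\<And>P. P \<in> \<P> \<Longrightarrow> z ` P \<subseteq> A (h P)"
      using refines_card_ge[OF part fin ref hit] by blast
    have "\<not> inj_on h \<P>" using False h(1) card_image[of h \<P>] by force
    then obtain R S where RS: "R \<in> \<P>" "S \<in> \<P>" "R \<noteq> S" "h R = h S"
      unfolding inj_on_def by blast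
    have "h P = h Q"
    proof (rule ccontr)
      assume ne: "h P \<noteq> h Q"
      obtain i j where ij: "i \<in> R" "j \<in> S" using finpart RS by blast
      have "linkage_dist z R S \<le> norm (z i - z j)"
        using linkage_dist_le[OF _ _ ij] finpart(1) RS by blast
      also have "\<dots> \<le> \<rho>"
      proof -
        have "h R \<in> {1..k}" using h(1) RS(1) by blast
        moreover have "z i \<in> A (h R)" "z j \<in> A (h R)"
          using h(2)[OF RS(1)] h(2)[OF RS(2)] RS(4) ij by auto
        ultimately have "dist (z i) (z j) \<le> \<rho>" by (rule near)
        then show ?thesis by (simp add: dist_norm)
      qed
      finally have 1: "linkage_dist z R S \<le> \<rho>" .
      obtain i' j' where ij': "i' \<in> P" "j' \<in> Q" "linkage_dist z P Q = norm (z i' - z j')"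
        using linkage_dist_attained[of P Q z] finpart PQ by blast
      have hk: "h P \<in> {1..k}" "h Q \<in> {1..k}" using h(1) PQ(1,2) by blast+
      have "z i' \<in> A (h P)" "z j' \<in> A (h Q)" using h(2)[OF PQ(1)] h(2)[OF PQ(2)] ij' by blast+
      then have "\<rho> < linkage_dist z P Q"
        using far[OF hk ne] ij'(3) by (simp add: dist_norm hull_inc)
      moreover have "linkage_dist z P Q \<le> linkage_dist z R S"
        using merge.hyps(5) RS by blast
      ultimately show False using 1 by linarith
    qed
    then have "z ` (P \<union> Q) \<subseteq> A (h P)" 
      using h(2)[OF PQ(1)] h(2)[OF PQ(2)] by (simp add: image_Un)
    moreover have "h P \<in> {1..k}" using h(1) PQ(1,2) by blast
    ultimately have "refines_clusters z (insert (P \<union> Q) (\<P> - {P, Q}))"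
      using ref unfolding refines_clusters_def by blast
    then show ?thesis using part' by blast
  qed
qed

text \<open>With exactly \<open>k\<close> components the surjection \<open>h\<close> onto
  \<open>{1..k}\<close> is injective, so no cluster is split between components.\<close>

lemma single_linkage_recovers:
  assumes "single_linkage z J \<P>" and fin: "finite J" and z: "\<And>j. j \<in> J \<Longrightarrow> z j \<in> X"
    and hit: "\<And>r. r \<in> {1..k} \<Longrightarrow> \<exists>j\<in>J. z j \<in> A r" and card: "card \<P> = k"
  shows "bij_betw (\<lambda>r. {j\<in>J. z j \<in> A r}) {1..k} \<P>"
proof -
  have part: "partition_on J \<P>" and ref: "refines_clusters z \<P>"
    using single_linkage_invariant[OF assms(1) fin z hit] card by auto
  obtain h where h: "h ` \<P> = {1..k}" "\<And>P. P \<in> \<P> \<Longrightarrow> z ` P \<subseteq> A (h P)"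
    using refines_card_ge[OF part fin ref hit] by blast
  have finP: "finite \<P>" using finite_elements[OF fin part] .
  have inj: "inj_on h \<P>" using h(1) card finP by (intro eq_card_imp_inj_on) auto
  have eq: "{j\<in>J. z j \<in> A (h P)} = P" if P: "P \<in> \<P>" for P
  proof
    show "P \<subseteq> {j\<in>J. z j \<in> A (h P)}" using P h(2) partition_onD1[OF part] by auto
    show "{j\<in>J. z j \<in> A (h P)} \<subseteq> P"
    proof
      fix j assume j: "j \<in> {j\<in>J. z j \<in> A (h P)}"
      then obtain Q where Q: "Q \<in> \<P>" "j \<in> Q" using partition_onD1[OF part] by blast
      have "h Q = h P" using Q j h P by (intro cluster_unique[of _ _ "z j"]) blast+
      then show "j \<in> P" using Q inj P by (auto dest: inj_onD)
    qed
  qed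
  have "bij_betw (inv_into \<P> h) {1..k} \<P>"
    using bij_betw_inv_into[of h \<P> "{1..k}"] inj h(1) unfolding bij_betw_def by blast
  moreover have "inv_into \<P> h r = {j\<in>J. z j \<in> A r}" if "r \<in> {1..k}" for r
    using eq[of "inv_into \<P> h r"] that h(1) by (metis f_inv_into_f inv_into_into)
  ultimately show ?thesis by (metis (no_types, lifting) bij_betw_cong)
qed

lemma buckshot_recovers:
  assumes b: "buckshot k m\<^sub>o z C0" and z: "\<And>j. j < m\<^sub>o \<Longrightarrow> z j \<in> X"
    and hit: "\<And>r. r \<in> {1..k} \<Longrightarrow> \<exists>j<m\<^sub>o. z j \<in> A r"
  obtains \<pi> where "\<pi> permutes {1..k}"
    "\<And>r. r \<in> {1..k} \<Longrightarrow> C0 (\<pi> r) = mean_of {j. j < m\<^sub>o \<and> z j \<in> A r} z"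
proof -
  obtain \<P> comp where sl: "single_linkage z {..<m\<^sub>o} \<P>" "card \<P> = k"
    and comp: "bij_betw comp {1..k} \<P>" and C0: "\<And>r. r \<in> {1..k} \<Longrightarrow> C0 r = mean_of (comp r) z"
    using b unfolding buckshot_def by blast
  let ?J = "\<lambda>r. {j. j < m\<^sub>o \<and> z j \<in> A r}"
  have J: "bij_betw ?J {1..k} \<P>"
    using single_linkage_recovers[OF sl(1) _ _ _ sl(2)] z hit by (simp add: Bex_def lessThan_def)
  \<comment> \<open>\<open>comp\<close> and \<open>?J\<close> enumerate the same components;
    \<open>g\<close> translates between the two numberings and is then extended by the identity, as
    \<open>permutes\<close> requires.\<close>
  define g where "g = inv_into {1..k} comp \<circ> ?J"
  have g: "bij_betw g {1..k} {1..k}"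
    unfolding g_def using J comp bij_betw_inv_into bij_betw_trans by blast
  define \<pi> where "\<pi> = (\<lambda>r. if r \<in> {1..k} then g r else r)"
  have "bij_betw \<pi> {1..k} {1..k}" using g bij_betw_cong[of "{1..k}" \<pi> g] unfolding \<pi>_def by auto
  then have "\<pi> permutes {1..k}" by (rule bij_imp_permutes) (auto simp: \<pi>_def)
  moreover have "C0 (\<pi> r) = mean_of (?J r) z" if r: "r \<in> {1..k}" for r
  proof -
    have "comp (g r) = ?J r"
      unfolding g_def comp_def using r J comp
      by (intro f_inv_into_f) (auto simp: bij_betw_def)
    moreover have "g r \<in> {1..k}" using g r by (auto simp: bij_betw_def)
    ultimately show ?thesis using C0[of "g r"] r by (simp add: \<pi>_def)
  qed
  ultimately show ?thesis using that by blast
qed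

end

section \<open>Decoupling the iterations into one recursion per cluster\<close>

text \<open>The update of one centroid with the test for the closest centroid replaced by membership
  in \<open>B\<close>: the other centroids disappear, and no choice of ties is left.\<close>

definition batch_update :: "'a::euclidean_space set \<Rightarrow> nat \<Rightarrow> real \<Rightarrow> 'a \<Rightarrow> (nat \<Rightarrow> 'a) \<Rightarrow> 'a" where
  "batch_update B m h c S =
     (let J = {j. j < m \<and> S j \<in> B} in
      if J = {} then c else (1 - h) *\<^sub>R c + h *\<^sub>R mean_of J S)"

text \<open>Batches are numbered from 1, as in the algorithm; \<open>S 0\<close> is never
  read.\<close>

primrec cluster_path ::
    "'a::euclidean_space set \<Rightarrow> nat \<Rightarrow> (nat \<Rightarrow> real) \<Rightarrow> 'a \<Rightarrow> (nat \<Rightarrow> nat \<Rightarrow> 'a) \<Rightarrow> nat \<Rightarrow> 'a" where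
  "cluster_path B m \<eta> c S 0 = c"
| "cluster_path B m \<eta> c S (Suc t) =
     batch_update B m (\<eta> (Suc t)) (cluster_path B m \<eta> c S t) (S (Suc t))"

lemma mean_of_in_hull:
  assumes "finite J" "J \<noteq> {}" "\<And>j. j \<in> J \<Longrightarrow> z j \<in> B"
  shows "mean_of J z \<in> convex hull B"
proof -
  have "(\<Sum>j\<in>J. (1 / real (card J)) *\<^sub>R z j) \<in> convex hull B"
    using assms by (intro convex_sum) (auto simp: hull_inc convex_convex_hull)
  then show ?thesis by (simp add: mean_of_def scaleR_sum_right divide_inverse)
qed

lemma batch_update_in_hull:
  assumes "c \<in> convex hull B" "0 \<le> h" "h \<le> 1"
  shows "batch_update B m h c S \<in> convex hull B"
proof -
  have "mean_of {j. j < m \<and> S j \<in> B} S \<in> convex hull B" if "{j. j < m \<and> S j \<in> B} \<noteq> {}"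
    using that by (intro mean_of_in_hull) auto
  then show ?thesis
    unfolding batch_update_def Let_def using assms
    by (auto intro!: convexD convex_convex_hull)
qed

lemma cluster_path_in_hull:
  assumes "c \<in> convex hull B" "\<And>t. 0 \<le> \<eta> t" "\<And>t. \<eta> t \<le> 1"
  shows "cluster_path B m \<eta> c S t \<in> convex hull B"
  by (induction t) (auto intro: assms batch_update_in_hull)

context separated_clustering
begin

lemma kmeans_step_recovers:
  assumes step: "kmeans_step k m (\<lambda>_. h) C S C'" and S: "\<And>j. j < m \<Longrightarrow> S j \<in> X"
    and \<pi>: "\<pi> permutes {1..k}"
    and C: "\<And>s. s \<in> {1..k} \<Longrightarrow> C (\<pi> s) \<in> convex hull (A s)"
    and r: "r \<in> {1..k}"
  shows "C' (\<pi> r) = batch_update (A r) m h (C (\<pi> r)) S"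
proof -
  obtain a where a: "\<And>j. j < m \<Longrightarrow> is_closest k C (S j) (a j)"
    and C': "\<And>r. r \<in> {1..k} \<Longrightarrow> C' r = (let J = {j. j < m \<and> a j = r} in
         if J = {} then C r else (1 - h) *\<^sub>R C r + h *\<^sub>R mean_of J S)"
    using step unfolding kmeans_step_def by blast
  have "a j = \<pi> r \<longleftrightarrow> S j \<in> A r" if j: "j < m" for j
  proof -
    obtain s where s: "s \<in> {1..k}" "S j \<in> A s" using S[OF j] cover by blast
    have "a j = \<pi> s" using is_closest_iff[OF \<pi> C s] a[OF j] by blast
    then show ?thesis
      using permutes_inj[OF \<pi>] s r cluster_unique by (metis injD)
  qed
  then have "{j. j < m \<and> a j = \<pi> r} = {j. j < m \<and> S j \<in> A r}" by blast
  moreover have "\<pi> r \<in> {1..k}" using permutes_in_image[OF \<pi>] r by blast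
  ultimately show ?thesis using C'[of "\<pi> r"] by (simp add: batch_update_def)
qed

text \<open>A single \<open>\<pi>\<close>, fixed by the seeding, works for all times: the induction
  hypothesis places each centroid in the hull of its cluster, which is what the next assignment step
  needs.\<close>

lemma stochastic_kmeans_recovers:
  assumes b: "buckshot k m\<^sub>o z (C 0)" and z: "\<And>j. j < m\<^sub>o \<Longrightarrow> z j \<in> X"
    and hit: "\<And>r. r \<in> {1..k} \<Longrightarrow> \<exists>j<m\<^sub>o. z j \<in> A r"
    and step: "\<And>t. t \<ge> 1 \<Longrightarrow> kmeans_step k m (\<lambda>_. \<eta> t) (C (t - 1)) (S t) (C t)"
    and S: "\<And>t j. t \<ge> 1 \<Longrightarrow> j < m \<Longrightarrow> S t j \<in> X"
    and \<eta>: "\<And>t. 0 \<le> \<eta> t" "\<And>t. \<eta> t \<le> 1"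
  obtains \<pi> where "\<pi> permutes {1..k}"
    "\<And>t r. r \<in> {1..k} \<Longrightarrow>
      C t (\<pi> r) = cluster_path (A r) m \<eta> (mean_of {j. j < m\<^sub>o \<and> z j \<in> A r} z) S t"
proof -
  obtain \<pi> where \<pi>: "\<pi> permutes {1..k}"
    and C0: "\<And>r. r \<in> {1..k} \<Longrightarrow> C 0 (\<pi> r) = mean_of {j. j < m\<^sub>o \<and> z j \<in> A r} z"
    using buckshot_recovers[OF b z hit] by blast
  have hull0: "mean_of {j. j < m\<^sub>o \<and> z j \<in> A r} z \<in> convex hull (A r)" if "r \<in> {1..k}" for r
    using hit[OF that] by (intro mean_of_in_hull) auto
  have "\<forall>r\<in>{1..k}. C t (\<pi> r) = cluster_path (A r) m \<eta> (mean_of {j. j < m\<^sub>o \<and> z j \<in> A r} z) S t" for t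
  proof (induction t)
    case 0
    then show ?case using C0 by simp
  next
    case (Suc t)
    have "C t (\<pi> s) \<in> convex hull (A s)" if "s \<in> {1..k}" for s
      using Suc that cluster_path_in_hull[OF hull0[OF that] \<eta>] by simp
    then show ?case
      using kmeans_step_recovers[OF _ _ \<pi>, of m "\<eta> (Suc t)" "C t" "S (Suc t)" "C (Suc t)"]
        step[of "Suc t"] S Suc by simp
  qed
  then show ?thesis using that \<pi> by blast
qed

end

section \<open>From clusterability to separation\<close>

text \<open>The residual of the projection is orthogonal to the line, so by Pythagoras projecting
  subtracts the same amount from both squared distances. A tied point thus has gap 0.\<close>

lemma closest_point_line_bisects:
  fixes a b x :: "'a::euclidean_space"
  assumes "norm (x - a) = norm (x - b)"
  shows "norm (closest_point (affine hull {a, b}) x - a) = norm (closest_point (affine hull {a, b}) x - b)"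
proof -
  let ?L = "affine hull {a, b}"
  define p where "p = closest_point ?L x"
  have L: "closed ?L" "convex ?L" "?L \<noteq> {}" by (auto simp: affine_imp_convex)
  have p: "p \<in> ?L" unfolding p_def by (intro closest_point_in_set) (use L in auto)
  have ab: "a \<in> ?L" "b \<in> ?L" by (auto simp: hull_inc)
  have mem: "p + t *\<^sub>R (b - a) \<in> ?L" for t
    using mem_affine_3_minus[OF affine_affine_hull p ab(2,1)] by blast
  have dot: "inner (x - p) (t *\<^sub>R (b - a)) \<le> 0" for t
    using closest_point_dot[OF L(2,1) mem[of t], of x] by (simp add: p_def)
  \<comment> \<open>The line extends in both directions, so the variational inequality becomes an
    equation.\<close>
  have "inner (x - p) (b - a) = 0" using dot[of 1] dot[of "-1"] by (auto simp: inner_diff_right)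
  moreover have "(norm (x - a))\<^sup>2 - (norm (x - b))\<^sup>2
      = 2 * inner (x - p) (b - a) + ((norm (p - a))\<^sup>2 - (norm (p - b))\<^sup>2)"
    unfolding power2_norm_eq_inner by (simp add: algebra_simps inner_commute)
  ultimately have "(norm (p - a))\<^sup>2 = (norm (p - b))\<^sup>2" using assms(1) by simp
  then show ?thesis by (simp add: p_def)
qed

lemma voronoi_clusteringE:
  assumes "A \<in> voronoi_clusterings X k C"
  obtains a where "\<And>x. x \<in> X \<Longrightarrow> is_closest k C x (a x)" "A = (\<lambda>r. {x\<in>X. a x = r})"
  using assms unfolding voronoi_clusterings_def by blast

lemma stationary_pointD:
  assumes "stationary_point X k C A" "finite X"
  shows stationary_cover: "X = (\<Union>r\<in>{1..k}. A r)"
    and stationary_disjoint: "r \<noteq> s \<Longrightarrow> A r \<inter> A s = {}"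
    and stationary_subset: "A r \<subseteq> X"
    and stationary_finite: "finite (A r)"
    and stationary_nonempty: "r \<in> {1..k} \<Longrightarrow> A r \<noteq> {}"
    and stationary_mean: "r \<in> {1..k} \<Longrightarrow> C r = mean_of (A r) (\<lambda>x. x)"
    and stationary_closest: "x \<in> A r \<Longrightarrow> is_closest k C x r"
proof -
  obtain a where a: "\<And>x. x \<in> X \<Longrightarrow> is_closest k C x (a x)" "A = (\<lambda>r. {x\<in>X. a x = r})"
    using assms unfolding stationary_point_def by (blast elim: voronoi_clusteringE)
  show "X = (\<Union>r\<in>{1..k}. A r)" using a unfolding is_closest_def by auto
  show "r \<noteq> s \<Longrightarrow> A r \<inter> A s = {}" "A r \<subseteq> X" "x \<in> A r \<Longrightarrow> is_closest k C x r"
    using a by auto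
  show "finite (A r)" using a assms(2) by simp
  show "r \<in> {1..k} \<Longrightarrow> A r \<noteq> {}" "r \<in> {1..k} \<Longrightarrow> C r = mean_of (A r) (\<lambda>x. x)"
    using assms(1) unfolding stationary_point_def by auto
qed

lemma is_closest_Min:
  assumes "is_closest k C x r"
  shows "(MIN s\<in>{1..k}. (norm (x - C s))\<^sup>2) = (norm (x - C r))\<^sup>2"
  using assms unfolding is_closest_def by (intro Min_eqI) (auto intro: power_mono)

lemma cost_eq_sum_clusters:
  assumes st: "stationary_point X k C A" and fin: "finite X"
  shows "cost X k D = (\<Sum>r\<in>{1..k}. \<Sum>x\<in>A r. MIN s\<in>{1..k}. (norm (x - D s))\<^sup>2)"
proof -
  have "cost X k D = (\<Sum>x\<in>(\<Union>r\<in>{1..k}. A r). MIN s\<in>{1..k}. (norm (x - D s))\<^sup>2)"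
    using stationary_cover[OF st fin] by (simp add: cost_def)
  also have "\<dots> = (\<Sum>r\<in>{1..k}. \<Sum>x\<in>A r. MIN s\<in>{1..k}. (norm (x - D s))\<^sup>2)"
    using stationary_finite[OF st fin] stationary_disjoint[OF st fin]
    by (intro sum.UNION_disjoint) auto
  finally show ?thesis .
qed

lemma cost_eq_sum_cluster_cost:
  assumes st: "stationary_point X k C A" and fin: "finite X"
  shows "cost X k C = (\<Sum>r\<in>{1..k}. cluster_cost C A r)"
  unfolding cost_eq_sum_clusters[OF assms] cluster_cost_def
  by (intro sum.cong refl is_closest_Min stationary_closest[OF st fin])

lemma cluster_cost_le_cost:
  assumes "stationary_point X k C A" "finite X" "r \<in> {1..k}"
  shows "cluster_cost C A r \<le> cost X k C"
  unfolding cost_eq_sum_cluster_cost[OF assms(1,2)]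
  by (rule member_le_sum[OF assms(3)]) (auto simp: cluster_cost_def intro: sum_nonneg)

text \<open>The margin refers to some clustering \<open>B\<close>, possibly with ties broken
  differently from \<open>A\<close>. A tied point has gap 0, so positivity of
  \<open>\<gamma>\<close> forces \<open>A q\<close> into \<open>B q\<close>; in particular
  \<open>B r\<close> is nonempty, and the gap at any of its points is at most the distance of the
  centroids by the triangle inequality.\<close>

lemma has_margin_le_dist:
  assumes st: "stationary_point X k C A" and fin: "finite X"
    and margin: "has_margin X k C \<gamma>" and pos: "\<gamma> > 0"
    and rs: "r \<in> {1..k}" "s \<in> {1..k}" "r \<noteq> s"
  shows "\<gamma> \<le> dist (C r) (C s)"
proof -
  let ?gap = "\<lambda>r s x. let xp = closest_point (affine hull {C r, C s}) x
        in \<bar>norm (xp - C r) - norm (xp - C s)\<bar>"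
  obtain B where B: "B \<in> voronoi_clusterings X k C"
    and Min: "\<gamma> = Min {margin_between C B r s | r s. r \<in> {1..k} \<and> s \<in> {1..k} \<and> r \<noteq> s}"
    using margin unfolding has_margin_def by blast
  obtain b where b: "\<And>x. x \<in> X \<Longrightarrow> is_closest k C x (b x)" "B = (\<lambda>r. {x\<in>X. b x = r})"
    using B by (blast elim: voronoi_clusteringE)
  have "{margin_between C B r s | r s. r \<in> {1..k} \<and> s \<in> {1..k} \<and> r \<noteq> s}
      \<subseteq> (\<lambda>(r, s). margin_between C B r s) ` ({1..k} \<times> {1..k})" by auto
  then have "finite {margin_between C B r s | r s. r \<in> {1..k} \<and> s \<in> {1..k} \<and> r \<noteq> s}"
    by (rule finite_subset) simp
  then have le: "\<gamma> \<le> margin_between C B r s" if "r \<in> {1..k}" "s \<in> {1..k}" "r \<noteq> s" for r s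
    unfolding Min using that by (intro Min_le) auto
  have gap: "\<gamma> \<le> ?gap r s x" if "r \<in> {1..k}" "s \<in> {1..k}" "r \<noteq> s" "x \<in> B r \<union> B s" for r s x
  proof -
    have "finite (B r \<union> B s)" using b(2) fin by simp
    then have "margin_between C B r s \<le> ?gap r s x"
      unfolding margin_between_def using that(4) by (intro Min_le) auto
    then show ?thesis using le[OF that(1-3)] by linarith
  qed
  have no_tie: "b x = q" if x: "x \<in> A q" for x q
  proof (rule ccontr)
    assume ne: "b x \<noteq> q"
    have X: "x \<in> X" using stationary_subset[OF st fin] x by blast
    have cl: "is_closest k C x q" "is_closest k C x (b x)"
      using stationary_closest[OF st fin x] b(1)[OF X] by auto
    then have mem: "q \<in> {1..k}" "b x \<in> {1..k}" and tie: "norm (x - C q) = norm (x - C (b x))"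
      unfolding is_closest_def by (auto intro: antisym)
    then have "?gap q (b x) x = 0" 
      using closest_point_line_bisects[OF tie] by (simp add: Let_def)
    moreover have "\<gamma> \<le> ?gap q (b x) x" using gap mem ne X b(2) by auto
    ultimately show False using pos by linarith
  qed
  obtain x where x: "x \<in> A r" using stationary_nonempty[OF st fin rs(1)] by blast
  then have "x \<in> B r" using no_tie stationary_subset[OF st fin] b(2) by auto
  then have "\<gamma> \<le> ?gap r s x" using gap rs by auto
  also have "\<dots> \<le> dist (C r) (C s)"
    unfolding Let_def dist_norm by norm
  finally show ?thesis .
qed

text \<open>\<open>w_min\<close> bounds the ratio of mean to maximal squared radius from below, so
  the cluster cost controls the radius. Its positivity excludes clusters consisting of their
  centroid only, whose coefficient 0/0 is 0, and thereby makes the cost positive.\<close>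

lemma radius_le:
  assumes st: "stationary_point X k C A" and fin: "finite X" and r: "r \<in> {1..k}"
    and w: "w_min k C A > 0" and x: "x \<in> A r"
  shows "(norm (x - C r))\<^sup>2 \<le> cluster_cost C A r / (real (card (A r)) * w_min k C A)"
    and "0 < cluster_cost C A r"
proof -
  let ?M = "MAX x\<in>A r. (norm (x - C r))\<^sup>2"
  have finA: "finite (A r)" using stationary_finite[OF st fin] .
  then have card: "real (card (A r)) > 0" using x card_gt_0_iff by fastforce
  have M: "(norm (x - C r))\<^sup>2 \<le> ?M" using finA x by (intro Max_ge) auto
  have "w_min k C A \<le> w_coeff C A r" unfolding w_min_def using r by (intro Min_le) auto
  then have wle: "w_min k C A \<le> (cluster_cost C A r / real (card (A r))) / ?M"
    by (simp add: w_coeff_def)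
  have M0: "?M > 0"
  proof (rule ccontr)
    assume "\<not> ?M > 0"
    moreover have "?M \<ge> 0" using M zero_le_power2 order_trans by blast
    ultimately have "?M = 0" by linarith
    then show False using w wle by simp
  qed
  have Mw: "?M * w_min k C A \<le> cluster_cost C A r / real (card (A r))"
    using wle unfolding pos_le_divide_eq[OF M0] by (simp only: mult.commute)
  have "(norm (x - C r))\<^sup>2 * w_min k C A \<le> cluster_cost C A r / real (card (A r))"
    using order_trans[OF mult_right_mono[OF M] Mw] w by simp
  then show "(norm (x - C r))\<^sup>2 \<le> cluster_cost C A r / (real (card (A r)) * w_min k C A)"
    using card w by (simp add: field_simps)
  have "0 < ?M * w_min k C A" using M0 w by simp
  then have "0 < cluster_cost C A r / real (card (A r))"
    using Mw by (rule less_le_trans)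
  then show "0 < cluster_cost C A r" using card by (simp add: zero_less_divide_iff)
qed

text \<open>
  The lower bound on \<open>f \<alpha>\<close> in terms of \<open>w\<^sub>m\<^sub>i\<^sub>n\<close> makes every cluster radius less than \<open>3/10\<close> of the
  margin, so all clusters are narrower than the gaps between them.
\<close>

lemma clusterable_imp_separated:
  assumes fin: "finite X" and cl: "clusterable f \<alpha> X k C A" and w: "w_min k C A > 0"
    and f: "f \<alpha> \<ge> 5 * sqrt (1 / (2 * w_min k C A) * L)" and L: "k \<ge> 2 \<Longrightarrow> L \<ge> 1"
  obtains \<rho> where "separated_clustering X k A \<rho>"
proof -
  have st: "stationary_point X k C A" using cl unfolding clusterable_def by blast
  note cover = stationary_cover[OF st fin] and nonempty = stationary_nonempty[OF st fin]
    and subset = stationary_subset[OF st fin]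
  show ?thesis
  proof (cases "k \<ge> 2")
    case False
    \<comment> \<open>With at most one cluster \<open>far\<close> is vacuous and any bound on the
      diameter will do.\<close>
    have "separated_clustering X k A (diameter X)"
    proof
      show "finite X" "X = (\<Union>r\<in>{1..k}. A r)" using fin cover by auto
      show "A r \<noteq> {}" if "r \<in> {1..k}" for r using nonempty that .
      show "dist x y \<le> diameter X" if "x \<in> A r" "y \<in> A r" for r x y
        using subset that fin by (intro diameter_bounded_bound finite_imp_bounded) blast+
      show "diameter X < dist x y" if "r \<in> {1..k}" "s \<in> {1..k}" "r \<noteq> s" for r s x y
        using False that by auto
    qed
    then show ?thesis by (rule that)
  next
    case True
    define \<phi> where "\<phi> = cost X k C"
    \<comment> \<open>The share of cluster \<open>r\<close> in the lower bound on the
      margin.\<close>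
    define R where "R r = f \<alpha> * sqrt \<phi> * (1 / sqrt (card (A r)))" for r
    obtain \<gamma> where margin: "has_margin X k C \<gamma>" and
      \<gamma>: "\<And>r s. r \<in> {1..k} \<Longrightarrow> s \<in> {1..k} \<Longrightarrow> r \<noteq> s \<Longrightarrow> \<gamma> \<ge> R r + R s"
      using cl unfolding clusterable_def R_def \<phi>_def by (auto simp: algebra_simps)
    have f0: "f \<alpha> > 0" using cl unfolding clusterable_def by auto
    have "25 / (2 * w_min k C A) \<le> (f \<alpha>)\<^sup>2"
    proof -
      have "25 / (2 * w_min k C A) \<le> (5 * sqrt (1 / (2 * w_min k C A) * L))\<^sup>2"
        using w L[OF True] by (simp add: power_mult_distrib real_sqrt_pow2 divide_right_mono)
      also have "\<dots> \<le> (f \<alpha>)\<^sup>2"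
        using f w L[OF True] by (intro power_mono) auto
      finally show ?thesis .
    qed
    \<comment> \<open>The previous estimate gives 1/w at most 0.08 f^2, rounded up to (3/10)^2
      f^2.\<close>
    then have w_inv: "1 / w_min k C A \<le> (3 / 10 * f \<alpha>)\<^sup>2"
      using w by (simp add: power_mult_distrib field_simps)
    have radius: "dist x (C r) \<le> 3 / 10 * R r" and R0: "0 < R r"
      if r: "r \<in> {1..k}" and x: "x \<in> A r" for r x
    proof -
      have card: "real (card (A r)) > 0"
        using x stationary_finite[OF st fin, of r] card_gt_0_iff by fastforce
      have \<phi>: "0 < \<phi>" "cluster_cost C A r \<le> \<phi>"
        using radius_le(2)[OF st fin r w x] cluster_cost_le_cost[OF st fin r]
        unfolding \<phi>_def by linarith+
      then show R0: "0 < R r" using f0 card by (simp add: R_def)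
      have "(norm (x - C r))\<^sup>2 \<le> cluster_cost C A r / real (card (A r)) * (1 / w_min k C A)"
        using radius_le(1)[OF st fin r w x] by simp
      also have "\<dots> \<le> \<phi> / real (card (A r)) * (3 / 10 * f \<alpha>)\<^sup>2"
        using \<phi> card w_inv w by (intro mult_mono divide_right_mono) auto
      also have "\<dots> = (3 / 10 * R r)\<^sup>2"
        using \<phi> card by (simp add: R_def power_mult_distrib power_divide mult_ac)
      finally have "norm (x - C r) \<le> 3 / 10 * R r"
        using R0 by (intro power2_le_imp_le[of "norm (x - C r)"]) simp_all
      then show "dist x (C r) \<le> 3 / 10 * R r" by (simp add: dist_norm)
    qed
    have radius_hull: "dist y (C r) \<le> 3 / 10 * R r"
      if r: "r \<in> {1..k}" and y: "y \<in> convex hull (A r)" for r y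
    proof -
      have "convex hull (A r) \<subseteq> cball (C r) (3 / 10 * R r)"
        using radius[OF r] by (intro hull_minimal) (auto simp: dist_commute)
      then show ?thesis using y by (auto simp: dist_commute)
    qed
    have R0: "0 < R r" if "r \<in> {1..k}" for r using nonempty[OF that] R0 that by blast
    have \<gamma>0: "0 < \<gamma>" using \<gamma>[of 1 2] R0[of 1] R0[of 2] True by simp
    have R\<gamma>: "R r < \<gamma>" if r: "r \<in> {1..k}" for r
    proof -
      obtain s :: nat where "s \<in> {1..k}" "s \<noteq> r"
        using True that by (cases "r = 1") (auto intro: that[of 1] that[of 2])
      then show ?thesis using \<gamma>[OF r] R0[of s] by fastforce
    qed
    \<comment> \<open>Diameters are at most 6/10 \<open>R r\<close>, below 6/10
      \<open>\<gamma>\<close>; gaps are at least \<open>\<gamma>\<close> minus 3/10 of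
      \<open>R r + R s\<close>, that is, at least 7/10 \<open>\<gamma>\<close>.\<close>
    have "separated_clustering X k A (6 / 10 * \<gamma>)"
    proof
      show "finite X" "X = (\<Union>r\<in>{1..k}. A r)" using fin cover by auto
      show "A r \<noteq> {}" if "r \<in> {1..k}" for r using nonempty that .
      show "dist x y \<le> 6 / 10 * \<gamma>" if r: "r \<in> {1..k}" and xy: "x \<in> A r" "y \<in> A r" for r x y
        using radius[OF r xy(1)] radius[OF r xy(2)] R\<gamma>[OF r] dist_triangle2[of x y "C r"]
        by linarith
      show "6 / 10 * \<gamma> < dist x y"
        if rs: "r \<in> {1..k}" "s \<in> {1..k}" "r \<noteq> s" and x: "x \<in> A r" and y: "y \<in> convex hull (A s)"
        for r s x y
      proof -
        have "\<gamma> \<le> dist (C r) (C s)" using has_margin_le_dist[OF st fin margin \<gamma>0 rs] .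
        also have "\<dots> \<le> dist x (C r) + dist x y + dist y (C s)"
          using dist_triangle[of "C r" "C s" x] dist_triangle[of x "C s" y]
          by (simp add: dist_commute)
        finally show ?thesis
          using radius[OF rs(1) x] radius_hull[OF rs(2) y] \<gamma>[OF rs] \<gamma>0 by linarith
      qed
    qed
    then show ?thesis by (rule that)
  qed
qed

section \<open>Expected distance of a single centroid\<close>

text \<open>A singleton of a finite product is a box, and every set is a finite union of singletons.
  The argument breaks down for the infinite sequence of batches, which is why later proofs pass to
  restrictions to \<open>{1..t}\<close>.\<close>

lemma sets_PiM_discrete:
  assumes I: "finite I"
    and M: "\<And>i. i \<in> I \<Longrightarrow> finite (space (M i))" "\<And>i. i \<in> I \<Longrightarrow> sets (M i) = Pow (space (M i))"
  shows "sets (PiM I M) = Pow (space (PiM I M))"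
proof
  show "sets (PiM I M) \<subseteq> Pow (space (PiM I M))" by (rule sets.space_closed)
  show "Pow (space (PiM I M)) \<subseteq> sets (PiM I M)"
  proof
    fix S assume "S \<in> Pow (space (PiM I M))"
    then have S: "S \<subseteq> PiE I (\<lambda>i. space (M i))" by (simp add: space_PiM)
    have sing: "{y} \<in> sets (PiM I M)" if y: "y \<in> S" for y
    proof -
      have "PiE I (\<lambda>i. {y i}) \<in> sets (PiM I M)"
        using S y M(2) by (intro sets_PiM_I_finite I) (auto simp: PiE_iff)
      moreover have "y \<in> extensional I" using S y by (auto simp: PiE_iff)
      ultimately show ?thesis by (simp add: PiE_over_singleton_iff PiE_singleton)
    qed
    have "finite S" by (rule finite_subset[OF S finite_PiE[OF I M(1)]])
    from sets.finite_UN[OF this sing] have "(\<Union>y\<in>S. {y}) \<in> sets (PiM I M)" .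
    then show "S \<in> sets (PiM I M)" by simp
  qed
qed

lemma integrable_discrete:
  fixes f :: "'a \<Rightarrow> real"
  assumes "finite_measure M" "finite (space M)" "sets M = Pow (space M)"
  shows "integrable M f"
proof -
  interpret finite_measure M by fact
  have "norm (f x) \<le> (\<Sum>y\<in>space M. \<bar>f y\<bar>)" if "x \<in> space M" for x
    using that assms(2) member_le_sum[of x "space M" "\<lambda>y. \<bar>f y\<bar>"] by simp
  moreover have "f \<in> borel_measurable M"
    using assms(3) by (auto simp: measurable_def)
  ultimately show ?thesis by (intro integrable_const_bound[of _ "\<Sum>y\<in>space M. \<bar>f y\<bar>"]) auto
qed

abbreviation iid_batch :: "'a set \<Rightarrow> nat \<Rightarrow> (nat \<Rightarrow> 'a) measure" where
  "iid_batch X m \<equiv> \<Pi>\<^sub>M j\<in>{..<m}. uniform_count_measure X"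

locale iid_sampling =
  fixes X :: "'a::euclidean_space set"
  assumes finite_X: "finite X" and nonempty_X: "X \<noteq> {}"
begin

lemma prob_space_unif: "prob_space (uniform_count_measure X)"
  using finite_X nonempty_X by (rule prob_space_uniform_count_measure)

lemma product_prob_space_unif: "product_prob_space (\<lambda>_. uniform_count_measure X)"
  by (intro product_prob_spaceI prob_space_unif)

lemma prob_space_batch: "prob_space (iid_batch X m)"
  by (intro prob_space_PiM prob_space_unif)

lemma space_batch: "space (iid_batch X m) = PiE {..<m} (\<lambda>_. X)"
  by (simp add: space_PiM space_uniform_count_measure)

lemma finite_space_batch: "finite (space (iid_batch X m))"
  using finite_X by (simp add: space_batch finite_PiE)

lemma sets_batch: "sets (iid_batch X m) = Pow (space (iid_batch X m))"
  using finite_X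
  by (intro sets_PiM_discrete) (auto simp: space_uniform_count_measure sets_uniform_count_measure)

lemma integrable_batch: "integrable (iid_batch X m) (f :: _ \<Rightarrow> real)"
  using prob_space_batch finite_space_batch sets_batch
  by (intro integrable_discrete) (auto dest: prob_space.finite_measure)

lemma measure_batch_miss:
  assumes "B \<subseteq> X"
  shows "measure (iid_batch X m) {y \<in> space (iid_batch X m). \<forall>j<m. y j \<notin> B}
    = (1 - real (card B) / real (card X)) ^ m"
proof -
  interpret product_prob_space "\<lambda>_::nat. uniform_count_measure X" by (rule product_prob_space_unif)
  have n: "real (card X) > 0" using finite_X nonempty_X by (simp add: card_gt_0_iff)
  have "card B \<le> card X" using assms finite_X by (rule card_mono[rotated])
  then have "measure (uniform_count_measure X) (X - B) = 1 - real (card B) / real (card X)"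
    using n finite_X nonempty_X assms
    by (simp add: measure_uniform_count_measure card_Diff_subset finite_subset diff_divide_distrib)
  moreover have "{y \<in> space (iid_batch X m). \<forall>j<m. y j \<notin> B} = PiE {..<m} (\<lambda>_. X - B)"
  proof (rule set_eqI)
    fix y
    show "y \<in> {y \<in> space (iid_batch X m). \<forall>j<m. y j \<notin> B} \<longleftrightarrow> y \<in> PiE {..<m} (\<lambda>_. X - B)"
      unfolding space_batch PiE_iff mem_Collect_eq by blast
  qed
  moreover have "measure (iid_batch X m) (PiE {..<m} (\<lambda>_. X - B))
      = measure (uniform_count_measure X) (X - B) ^ m"
  proof -
    have "emeasure (iid_batch X m) (PiE {..<m} (\<lambda>_. X - B))
        = (\<Prod>j<m. emeasure (uniform_count_measure X) (X - B))"
      by (rule emeasure_PiM) (simp_all add: sets_uniform_count_measure)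
    also have "\<dots> = ennreal (measure (uniform_count_measure X) (X - B) ^ m)"
      unfolding M.emeasure_eq_measure by (simp add: ennreal_power)
    finally show ?thesis by (rule measure_eq_emeasure_eq_ennreal[rotated]) simp
  qed
  ultimately show ?thesis by simp
qed

text \<open>Coordinate \<open>j\<close> is integrated first, as an average over \<open>X\<close>;
  this is the resampling behind unbiasedness.\<close>

lemma integral_batch_coordinate:
  fixes f :: "(nat \<Rightarrow> 'a) \<Rightarrow> real"
  assumes j: "j < m"
  shows "(\<integral>y. f y \<partial>iid_batch X m)
    = (\<integral>y. (\<Sum>x\<in>X. f (y(j := x))) / real (card X) \<partial>(\<Pi>\<^sub>M i\<in>{..<m} - {j}. uniform_count_measure X))"
proof -
  interpret product_prob_space "\<lambda>_::nat. uniform_count_measure X" by (rule product_prob_space_unif)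
  have ins: "insert j ({..<m} - {j}) = {..<m}" using j by auto
  show ?thesis
    using product_integral_insert[of "{..<m} - {j}" j f] integrable_batch[of m f]
    unfolding ins using finite_X by (simp add: integral_uniform_count_measure)
qed

text \<open>
  The batch mean restricted to \<open>B\<close> is a ratio with random denominator. It is unbiased because
  resampling one coordinate within \<open>B\<close> leaves the denominator unchanged.
\<close>

lemma integral_batch_mean_eq_0:
  fixes g :: "'a \<Rightarrow> real"
  assumes B: "B \<subseteq> X" and g: "(\<Sum>x\<in>B. g x) = 0"
  shows "(\<integral>y. mean_of {j. j < m \<and> y j \<in> B} (\<lambda>j. g (y j)) \<partial>iid_batch X m) = 0"
proof -
  let ?J = "\<lambda>y. {j. j < m \<and> y j \<in> B}"
  let ?f = "\<lambda>j y. (if y j \<in> B then g (y j) / real (card (?J y)) else 0)"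
  have "mean_of (?J y) (\<lambda>j. g (y j)) = (\<Sum>j<m. ?f j y)" for y
  proof -
    have "mean_of (?J y) (\<lambda>j. g (y j)) = (\<Sum>j\<in>?J y. g (y j) / real (card (?J y)))"
      by (simp add: mean_of_def sum_divide_distrib divide_inverse sum_distrib_left mult.commute)
    also have "\<dots> = (\<Sum>j<m. ?f j y)"
      by (rule sum.mono_neutral_cong_left) auto
    finally show ?thesis .
  qed
  then have "(\<integral>y. mean_of (?J y) (\<lambda>j. g (y j)) \<partial>iid_batch X m)
      = (\<Sum>j<m. \<integral>y. ?f j y \<partial>iid_batch X m)"
    using integrable_batch by simp
  also have "\<dots> = (\<Sum>j<m. 0)"
  proof (rule sum.cong[OF refl])
    fix j assume "j \<in> {..<m}"
    then have j: "j < m" by simp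
    have "(\<Sum>x\<in>X. ?f j (y(j := x))) = 0" for y
    proof -
      \<comment> \<open>Points outside \<open>B\<close> contribute 0; for those inside, the
        denominator counts \<open>j\<close> itself and the hits at other positions, whatever
        \<open>x\<close> is.\<close>
      have "(\<Sum>x\<in>X. ?f j (y(j := x)))
          = (\<Sum>x\<in>B. g x / real (Suc (card {i. i < m \<and> i \<noteq> j \<and> y i \<in> B})))"
      proof (rule sum.mono_neutral_cong_right[OF finite_X B])
        fix x assume x: "x \<in> B"
        have "?J (y(j := x)) = insert j {i. i < m \<and> i \<noteq> j \<and> y i \<in> B}" using x j by auto
        then have "card (?J (y(j := x))) = Suc (card {i. i < m \<and> i \<noteq> j \<and> y i \<in> B})" by simp
        then show "?f j (y(j := x)) = g x / real (Suc (card {i. i < m \<and> i \<noteq> j \<and> y i \<in> B}))"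
          using x by (simp only: fun_upd_same if_True)
      qed auto
      then show ?thesis using g by (simp only: flip: sum_divide_distrib)
    qed
    then show "(\<integral>y. ?f j y \<partial>iid_batch X m) = 0"
      using integral_batch_coordinate[OF j, of "?f j"] by simp
  qed
  finally show ?thesis by simp
qed

end

section \<open>One-step contraction and the 1/t bound\<close>

text \<open>Expanding the square of (1 - h)(c - b) + h z leaves a cross term and two terms of order
  h^2, each at most h^2 M^2. A batch that misses \<open>B\<close> fits the same formula: the
  indicator switches the contraction off, and the cross term is 0 because \<open>mean_of\<close> of
  the empty set is 0.\<close>

lemma batch_update_dist_le:
  fixes b :: "'a::euclidean_space" and m :: nat
  assumes M: "\<And>x. x \<in> B \<Longrightarrow> norm (x - b) \<le> M" and c: "norm (c - b) \<le> M"
    and h: "0 \<le> h" "h \<le> 1"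
  defines "J \<equiv> \<lambda>S. {j. j < m \<and> S j \<in> B}"
  shows "(norm (batch_update B m h c S - b))\<^sup>2 \<le>
    (norm (c - b))\<^sup>2 - 2 * h * (1 - indicator {S. J S = {}} S) * (norm (c - b))\<^sup>2
    + 2 * h * (1 - h) * mean_of (J S) (\<lambda>j. inner (c - b) (S j - b)) + 2 * h\<^sup>2 * M\<^sup>2"
proof -
  have J: "{j. j < m \<and> S j \<in> B} = J S" by (simp add: J_def)
  show ?thesis
  proof (cases "J S = {}")
    case True
    then show ?thesis unfolding batch_update_def Let_def J by (simp add: mean_of_def)
  next
    case False
    have fin: "finite (J S)" by (simp add: J_def)
    then have n: "real (card (J S)) > 0" using False by (simp add: card_gt_0_iff)
    define z where "z = mean_of (J S) S - b"
    have z: "z = mean_of (J S) (\<lambda>j. S j - b)"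
      
      using n by (simp add: z_def mean_of_def sum_subtractf scaleR_diff_right sum_constant_scaleR)
    have zM: "norm z \<le> M"
    proof -
      have "norm z = norm (\<Sum>j\<in>J S. S j - b) / real (card (J S))"
        unfolding z mean_of_def by (simp add: divide_inverse)
      also have "\<dots> \<le> (\<Sum>j\<in>J S. norm (S j - b)) / real (card (J S))"
        by (intro divide_right_mono norm_sum) simp
      also have "(\<Sum>j\<in>J S. norm (S j - b)) \<le> real (card (J S)) * M"
        using M by (intro sum_bounded_above) (auto simp: J_def)
      finally show ?thesis using n by (simp add: divide_right_mono)
    qed
    have inner: "mean_of (J S) (\<lambda>j. inner (c - b) (S j - b)) = inner (c - b) z"
      by (simp add: z mean_of_def inner_sum_right)
    have upd: "batch_update B m h c S - b = (1 - h) *\<^sub>R (c - b) + h *\<^sub>R z"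
      unfolding batch_update_def Let_def J using False by (simp add: z_def algebra_simps)
    have "(norm (batch_update B m h c S - b))\<^sup>2
        = (1 - h)\<^sup>2 * (norm (c - b))\<^sup>2 + 2 * h * (1 - h) * inner (c - b) z + h\<^sup>2 * (norm z)\<^sup>2"
      unfolding upd power2_norm_eq_inner
      by (simp add: inner_add_left inner_add_right inner_commute power2_eq_square algebra_simps)
    moreover have "(1 - h)\<^sup>2 * (norm (c - b))\<^sup>2
        = (norm (c - b))\<^sup>2 - 2 * h * (norm (c - b))\<^sup>2 + h\<^sup>2 * (norm (c - b))\<^sup>2"
      by (simp add: power2_eq_square algebra_simps)
    moreover have "h\<^sup>2 * (norm (c - b))\<^sup>2 \<le> h\<^sup>2 * M\<^sup>2"
      using c by (intro mult_left_mono power_mono) auto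
    moreover have "h\<^sup>2 * (norm z)\<^sup>2 \<le> h\<^sup>2 * M\<^sup>2"
      using zM by (intro mult_left_mono power_mono) auto
    moreover have "indicator {S. J S = {}} S = (0 :: real)" using False by simp
    ultimately show ?thesis unfolding inner by simp
  qed
qed

lemma sum_diff_mean_eq_0:
  assumes "finite B"
  shows "(\<Sum>x\<in>B. x - mean_of B (\<lambda>x. x)) = 0"
  using assms by (cases "B = {}") (simp_all add: sum_subtractf mean_of_def sum_constant_scaleR)

lemma cluster_path_cong:
  assumes "\<And>i. 1 \<le> i \<Longrightarrow> i \<le> t \<Longrightarrow> S i = S' i"
  shows "cluster_path B m \<eta> c S t = cluster_path B m \<eta> c S' t"
  using assms by (induction t) auto

context iid_sampling
begin

text \<open>Only two quantities in the pointwise bound are random: the miss indicator, with mean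
  \<open>1 - q\<close>, and the cross term, with mean 0 since \<open>b\<close> is the mean of
  \<open>B\<close>.\<close>

lemma nn_integral_batch_update:
  assumes B: "B \<subseteq> X" and b: "b = mean_of B (\<lambda>x. x)"
    and M: "\<And>x. x \<in> B \<Longrightarrow> norm (x - b) \<le> M" and c: "norm (c - b) \<le> M"
    and h: "0 \<le> h" "h \<le> 1"
    and q: "q = 1 - (1 - real (card B) / real (card X)) ^ m"
  shows "(\<integral>\<^sup>+y. ennreal ((norm (batch_update B m h c y - b))\<^sup>2) \<partial>iid_batch X m)
    \<le> ennreal ((1 - 2 * h * q) * (norm (c - b))\<^sup>2 + 2 * h\<^sup>2 * M\<^sup>2)"
proof -
  interpret prob_space "iid_batch X m" by (rule prob_space_batch)
  let ?J = "\<lambda>S. {j. j < m \<and> S j \<in> B}"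
  let ?d = "(norm (c - b))\<^sup>2"
  let ?g = "\<lambda>x. inner (c - b) (x - b)"
  let ?F = "\<lambda>S. ?d - 2 * h * (1 - indicator {S. ?J S = {}} S) * ?d
    + 2 * h * (1 - h) * mean_of (?J S) (\<lambda>j. ?g (S j)) + 2 * h\<^sup>2 * M\<^sup>2"
  have le: "(norm (batch_update B m h c y - b))\<^sup>2 \<le> ?F y" for y
    using batch_update_dist_le[OF M c h] by simp
  have "(\<integral>\<^sup>+y. ennreal ((norm (batch_update B m h c y - b))\<^sup>2) \<partial>iid_batch X m)
      \<le> (\<integral>\<^sup>+y. ennreal (?F y) \<partial>iid_batch X m)"
    using le by (intro nn_integral_mono ennreal_leI)
  \<comment> \<open>\<open>?F\<close> dominates a square and is therefore nonnegative, so the two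
    integrals agree.\<close>
  also have "\<dots> = ennreal (\<integral>y. ?F y \<partial>iid_batch X m)"
    using le order_trans[OF zero_le_power2]
    by (intro nn_integral_eq_integral integrable_batch) auto
  also have "(\<integral>y. ?F y \<partial>iid_batch X m) = (1 - 2 * h * q) * ?d + 2 * h\<^sup>2 * M\<^sup>2"
  proof -
    have "(\<Sum>x\<in>B. ?g x) = inner (c - b) (\<Sum>x\<in>B. x - b)" by (simp add: inner_sum_right)
    then have "(\<Sum>x\<in>B. ?g x) = 0"
      using sum_diff_mean_eq_0[of B] finite_subset[OF B finite_X] b by simp
    then have mean: "(\<integral>y. mean_of (?J y) (\<lambda>j. ?g (y j)) \<partial>iid_batch X m) = 0"
      by (rule integral_batch_mean_eq_0[OF B])
    have ind: "(\<integral>y. indicator {S. ?J S = {}} y \<partial>iid_batch X m) = 1 - q"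
    proof -
      have "(\<integral>y. indicator {S. ?J S = {}} y \<partial>iid_batch X m)
          = measure (iid_batch X m) ({S. ?J S = {}} \<inter> space (iid_batch X m))"
        by simp
      also have "{S. ?J S = {}} \<inter> space (iid_batch X m) = {y \<in> space (iid_batch X m). \<forall>j<m. y j \<notin> B}"
        by auto
      finally show ?thesis using measure_batch_miss[OF B, of m] q by simp
    qed
    have "(\<integral>y. ?F y \<partial>iid_batch X m) = ?d
      - 2 * h * (1 - (\<integral>y. indicator {S. ?J S = {}} y \<partial>iid_batch X m)) * ?d
      + 2 * h * (1 - h) * (\<integral>y. mean_of (?J y) (\<lambda>j. ?g (y j)) \<partial>iid_batch X m) + 2 * h\<^sup>2 * M\<^sup>2"
      by (simp add: integrable_batch prob_space)
    then show ?thesis unfolding mean ind by (simp add: algebra_simps)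
  qed
  finally show ?thesis .
qed

lemma measurable_batches:
  assumes "finite I"
  shows "(f :: _ \<Rightarrow> 'b::topological_space) \<in> borel_measurable (PiM I (\<lambda>_. iid_batch X m))"
proof -
  have "sets (PiM I (\<lambda>_. iid_batch X m)) = Pow (space (PiM I (\<lambda>_. iid_batch X m)))"
    by (intro sets_PiM_discrete assms finite_space_batch sets_batch)
  then show ?thesis by (auto simp: measurable_def)
qed

text \<open>The first condition on \<open>K\<close> covers time 0, the second the noise 2 \<eta>^2
  M^2. Since c' times the hit probability is at least 1, the contraction factor is at most 1 -
  2/\<tau>. Nonnegative integrals keep integrability out of the recursion.\<close>

lemma nn_integral_cluster_path:
  assumes B: "B \<subseteq> X" and b: "b = mean_of B (\<lambda>x. x)"
    and M: "\<And>x. x \<in> B \<Longrightarrow> norm (x - b) \<le> M" and c: "c \<in> convex hull B"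
    and \<eta>: "\<And>t. \<eta> t = c' / (real t + t\<^sub>o)" and c': "0 < c'" "c' \<le> t\<^sub>o" and t\<^sub>o: "1 < t\<^sub>o"
    and q: "1 \<le> c' * (1 - (1 - real (card B) / real (card X)) ^ m)"
    and K: "M\<^sup>2 * t\<^sub>o \<le> K" "2 * c'\<^sup>2 * M\<^sup>2 \<le> K"
  shows "(\<integral>\<^sup>+S. ennreal ((norm (cluster_path B m \<eta> c S t - b))\<^sup>2) \<partial>(\<Pi>\<^sub>M t\<in>{1..}. iid_batch X m))
    \<le> ennreal (K / (real t + t\<^sub>o))"
proof -
  interpret P: product_prob_space "\<lambda>_::nat. iid_batch X m" "{1..}"
    by (intro product_prob_spaceI prob_space_batch)
  let ?P = "\<lambda>t. \<Pi>\<^sub>M t\<in>{1..t::nat}. iid_batch X m"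
  let ?d = "\<lambda>S t. (norm (cluster_path B m \<eta> c S t - b))\<^sup>2"
  have \<eta>01: "0 \<le> \<eta> t" "\<eta> t \<le> 1" for t using c' t\<^sub>o by (auto simp: \<eta> divide_le_eq)
  have path: "norm (cluster_path B m \<eta> c S t - b) \<le> M" for S t
  proof -
    have "convex hull B \<subseteq> cball b M"
      using M by (intro hull_minimal) (auto simp: dist_norm norm_minus_commute)
    moreover have "cluster_path B m \<eta> c S t \<in> convex hull B"
      using c \<eta>01 by (rule cluster_path_in_hull)
    ultimately show ?thesis by (auto simp: dist_norm norm_minus_commute)
  qed
  have K0: "0 \<le> K" using K(2) by (rule order_trans[rotated]) simp
  \<comment> \<open>On the finite product every function is measurable; the infinite product is
    reduced to it afterwards.\<close>
  have "(\<integral>\<^sup>+S. ennreal (?d S t) \<partial>?P t) \<le> ennreal (K / (real t + t\<^sub>o))"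
  proof (induction t)
    case 0
    have "(norm (c - b))\<^sup>2 \<le> M\<^sup>2" using path[of _ 0] by (intro power_mono) auto
    also have "M\<^sup>2 \<le> K / t\<^sub>o" using K(1) t\<^sub>o by (simp add: le_divide_eq)
    finally have "(norm (c - b))\<^sup>2 \<le> K / t\<^sub>o" .
    moreover have "emeasure (?P 0) (space (?P 0)) = 1"
      by (intro prob_space.emeasure_space_1 prob_space_PiM prob_space_batch)
    ultimately show ?case by (simp add: ennreal_leI)
  next
    case (Suc t)
    define \<tau> where "\<tau> = real (Suc t) + t\<^sub>o"
    \<comment> \<open>This makes \<open>1 - 2 / \<tau>\<close> nonnegative, so that products with it
      pass through \<open>ennreal\<close>.\<close>
    have \<tau>: "\<tau> > 2" using t\<^sub>o by (simp add: \<tau>_def)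
    have \<eta>\<tau>: "\<eta> (Suc t) = c' / \<tau>" by (simp add: \<eta> \<tau>_def)
    have ins: "{1..Suc t} = insert (Suc t) {1..t}" by auto
    have step: "(\<integral>\<^sup>+y. ennreal (?d (S(Suc t := y)) (Suc t)) \<partial>iid_batch X m)
        \<le> ennreal (1 - 2 / \<tau>) * ennreal (?d S t) + ennreal (K / \<tau>\<^sup>2)" for S
    proof -
      define q where "q = 1 - (1 - real (card B) / real (card X)) ^ m"
      have "cluster_path B m \<eta> c (S(Suc t := y)) (Suc t)
          = batch_update B m (\<eta> (Suc t)) (cluster_path B m \<eta> c S t) y" for y
        using cluster_path_cong[of t "S(Suc t := y)" S] by simp
      then have "(\<integral>\<^sup>+y. ennreal (?d (S(Suc t := y)) (Suc t)) \<partial>iid_batch X m)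
          \<le> ennreal ((1 - 2 * \<eta> (Suc t) * q) * ?d S t + 2 * (\<eta> (Suc t))\<^sup>2 * M\<^sup>2)"
        using nn_integral_batch_update[OF B b M path \<eta>01 q_def] by simp
      also have "\<dots> \<le> ennreal ((1 - 2 / \<tau>) * ?d S t + K / \<tau>\<^sup>2)"
      proof (intro ennreal_leI add_mono mult_right_mono)
        have "1 / \<tau> \<le> c' * q / \<tau>" using q \<tau> by (intro divide_right_mono) (auto simp: q_def)
        then show "1 - 2 * \<eta> (Suc t) * q \<le> 1 - 2 / \<tau>" by (simp add: \<eta>\<tau>)
        have "2 * (\<eta> (Suc t))\<^sup>2 * M\<^sup>2 = (2 * c'\<^sup>2 * M\<^sup>2) / \<tau>\<^sup>2"
          by (simp add: \<eta>\<tau> power_divide)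
        also have "\<dots> \<le> K / \<tau>\<^sup>2" using K(2) by (rule divide_right_mono) simp
        finally show "2 * (\<eta> (Suc t))\<^sup>2 * M\<^sup>2 \<le> K / \<tau>\<^sup>2" .
      qed simp
      also have "\<dots> = ennreal (1 - 2 / \<tau>) * ennreal (?d S t) + ennreal (K / \<tau>\<^sup>2)"
        using \<tau> K0 by (simp add: ennreal_plus ennreal_mult)
      finally show ?thesis .
    qed
    have "(\<integral>\<^sup>+S. ennreal (?d S (Suc t)) \<partial>?P (Suc t))
        = (\<integral>\<^sup>+S. (\<integral>\<^sup>+y. ennreal (?d (S(Suc t := y)) (Suc t)) \<partial>iid_batch X m) \<partial>?P t)"
      unfolding ins by (rule P.product_nn_integral_insert) (auto intro!: measurable_batches)
    also have "\<dots> \<le> (\<integral>\<^sup>+S. ennreal (1 - 2 / \<tau>) * ennreal (?d S t) + ennreal (K / \<tau>\<^sup>2) \<partial>?P t)"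
      using step by (intro nn_integral_mono)
    also have "\<dots> = ennreal (1 - 2 / \<tau>) * (\<integral>\<^sup>+S. ennreal (?d S t) \<partial>?P t) + ennreal (K / \<tau>\<^sup>2)"
    proof -
      interpret T: prob_space "?P t" by (intro prob_space_PiM prob_space_batch)
      have "(\<integral>\<^sup>+S. ennreal (1 - 2 / \<tau>) * ennreal (?d S t) + ennreal (K / \<tau>\<^sup>2) \<partial>?P t)
          = (\<integral>\<^sup>+S. ennreal (1 - 2 / \<tau>) * ennreal (?d S t) \<partial>?P t) + (\<integral>\<^sup>+S. ennreal (K / \<tau>\<^sup>2) \<partial>?P t)"
        by (intro nn_integral_add measurable_batches) simp_all
      also have "(\<integral>\<^sup>+S. ennreal (1 - 2 / \<tau>) * ennreal (?d S t) \<partial>?P t)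
          = ennreal (1 - 2 / \<tau>) * (\<integral>\<^sup>+S. ennreal (?d S t) \<partial>?P t)"
        by (intro nn_integral_cmult measurable_batches) simp
      also have "(\<integral>\<^sup>+S. ennreal (K / \<tau>\<^sup>2) \<partial>?P t) = ennreal (K / \<tau>\<^sup>2)"
        unfolding nn_integral_const T.emeasure_space_1 by simp
      finally show ?thesis .
    qed
    also have "\<dots> \<le> ennreal (1 - 2 / \<tau>) * ennreal (K / (real t + t\<^sub>o)) + ennreal (K / \<tau>\<^sup>2)"
      
      by (intro add_right_mono mult_left_mono[OF Suc.IH]) simp
    also have "\<dots> = ennreal ((1 - 2 / \<tau>) * (K / (\<tau> - 1)) + K / \<tau>\<^sup>2)"
    proof -
      have "0 \<le> 1 - 2 / \<tau>" "0 \<le> K / (\<tau> - 1)" "0 \<le> K / \<tau>\<^sup>2" using \<tau> K0 by simp_all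
      moreover have "real t + t\<^sub>o = \<tau> - 1" by (simp add: \<tau>_def)
      ultimately show ?thesis by (simp only: ennreal_plus ennreal_mult mult_nonneg_nonneg)
    qed
    also have "\<dots> \<le> ennreal (K / \<tau>)"
    proof (rule ennreal_leI)
      \<comment> \<open>The contraction undershoots 1/\<tau> by 1/(\<tau> (\<tau> - 1)), which
        leaves room for the noise 1/\<tau>^2.\<close>
      have "(1 - 2 / \<tau>) * (1 / (\<tau> - 1)) + 1 / \<tau>\<^sup>2 \<le> 1 / \<tau>"
      proof -
        have "(1 - 2 / \<tau>) * (1 / (\<tau> - 1)) = 1 / \<tau> - 1 / (\<tau> * (\<tau> - 1))"
          using \<tau> by (simp add: field_simps)
        moreover have "1 / \<tau>\<^sup>2 \<le> 1 / (\<tau> * (\<tau> - 1))"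
          using \<tau> by (intro divide_left_mono) (simp_all add: power2_eq_square)
        ultimately show ?thesis by linarith
      qed
      from mult_left_mono[OF this K0]
      show "(1 - 2 / \<tau>) * (K / (\<tau> - 1)) + K / \<tau>\<^sup>2 \<le> K / \<tau>"
        by (simp add: algebra_simps)
    qed
    finally show ?case by (simp add: \<tau>_def)
  qed
  moreover have "(\<integral>\<^sup>+S. ennreal (?d S t) \<partial>(\<Pi>\<^sub>M t\<in>{1..}. iid_batch X m)) = (\<integral>\<^sup>+S. ennreal (?d S t) \<partial>?P t)"
  proof -
    have "(\<integral>\<^sup>+S. ennreal (?d S t) \<partial>?P t)
        = (\<integral>\<^sup>+S. ennreal (?d S t) \<partial>distr (\<Pi>\<^sub>M t\<in>{1..}. iid_batch X m) (?P t) (\<lambda>S. restrict S {1..t}))"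
    proof -
      have "distr (\<Pi>\<^sub>M t\<in>{1..}. iid_batch X m) (?P t) (\<lambda>S. restrict S {1..t}) = ?P t"
        by (rule P.distr_PiM_restrict_finite) auto
      then show ?thesis by simp
    qed
    also have "\<dots> = (\<integral>\<^sup>+S. ennreal (?d (restrict S {1..t}) t) \<partial>(\<Pi>\<^sub>M t\<in>{1..}. iid_batch X m))"
      by (subst nn_integral_distr) (auto intro!: measurable_restrict_subset measurable_batches)
    also have "\<dots> = (\<integral>\<^sup>+S. ennreal (?d S t) \<partial>(\<Pi>\<^sub>M t\<in>{1..}. iid_batch X m))"
    proof -
      have "?d (restrict S {1..t}) t = ?d S t" for S
        using cluster_path_cong[of t "restrict S {1..t}" S] by simp
      then show ?thesis by simp
    qed
    finally show ?thesis by simp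
  qed
  ultimately show ?thesis by simp
qed

end

section \<open>Convergence of stochastic \<open>k\<close>-means\<close>

text \<open>The parallel axis identity: cross terms cancel because deviations from the mean sum to
  0.\<close>

lemma sum_dist_mean:
  fixes d :: "'a::euclidean_space"
  assumes "finite B" "b = mean_of B (\<lambda>x. x)"
  shows "(\<Sum>x\<in>B. (norm (x - d))\<^sup>2) = (\<Sum>x\<in>B. (norm (x - b))\<^sup>2) + real (card B) * (norm (d - b))\<^sup>2"
proof -
  have "(norm (x - d))\<^sup>2 = (norm (x - b))\<^sup>2 + (norm (d - b))\<^sup>2 - 2 * inner (x - b) (d - b)" for x
    unfolding power2_norm_eq_inner by (simp add: algebra_simps inner_commute)
  moreover have "(\<Sum>x\<in>B. 2 * inner (x - b) (d - b)) = 0"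
  proof -
    have "(\<Sum>x\<in>B. 2 * inner (x - b) (d - b)) = 2 * inner (\<Sum>x\<in>B. x - b) (d - b)"
      by (simp only: inner_sum_left sum_distrib_left)
    then show ?thesis using sum_diff_mean_eq_0[OF assms(1)] assms(2) by simp
  qed
  ultimately show ?thesis by (simp add: sum.distrib sum_subtractf)
qed

lemma centroidal_dist_le:
  assumes "\<pi> permutes {1..k}"
  shows "centroidal_dist k A D C \<le> (\<Sum>r\<in>{1..k}. real (card (A r)) * (norm (D (\<pi> r) - C r))\<^sup>2)"
  unfolding centroidal_dist_def using assms
  by (intro Min_le) (auto simp: finite_permutations)

lemma centroidal_dist_attained:
  obtains \<pi> where "\<pi> permutes {1..k}"
    "centroidal_dist k A D C = (\<Sum>r\<in>{1..k}. real (card (A r)) * (norm (D (\<pi> r) - C r))\<^sup>2)"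
proof -
  let ?S = "(\<lambda>\<pi>. \<Sum>r\<in>{1..k}. real (card (A r)) * (norm (D (\<pi> r) - C r))\<^sup>2) ` {\<pi>. \<pi> permutes {1..k}}"
  have "finite ?S" by (simp add: finite_permutations)
  moreover have "?S \<noteq> {}" using permutes_id by blast
  ultimately have "Min ?S \<in> ?S" by (rule Min_in)
  then show ?thesis using that unfolding centroidal_dist_def by blast
qed

lemma centroidal_dist_nonneg: "0 \<le> centroidal_dist k A D C"
  by (rule centroidal_dist_attained[of k A D C]) (simp add: sum_nonneg)

text \<open>Charging each cluster \<open>A r\<close> to the centroid \<open>D (\<pi> r)\<close> of
  an optimal matching can only increase the cost, and the parallel axis identity turns the excess
  over \<open>cost X k C\<close> into the centroidal distance.\<close>

lemma cost_le_centroidal_dist: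
  assumes st: "stationary_point X k C A" and fin: "finite X"
  shows "cost X k D \<le> cost X k C + centroidal_dist k A D C"
proof -
  obtain \<pi> where \<pi>: "\<pi> permutes {1..k}"
    "centroidal_dist k A D C = (\<Sum>r\<in>{1..k}. real (card (A r)) * (norm (D (\<pi> r) - C r))\<^sup>2)"
    by (rule centroidal_dist_attained)
  have "cost X k D = (\<Sum>r\<in>{1..k}. \<Sum>x\<in>A r. MIN s\<in>{1..k}. (norm (x - D s))\<^sup>2)"
    by (rule cost_eq_sum_clusters[OF assms])
  also have "\<dots> \<le> (\<Sum>r\<in>{1..k}. \<Sum>x\<in>A r. (norm (x - D (\<pi> r)))\<^sup>2)"
  proof (intro sum_mono)
    fix r x assume "r \<in> {1..k}"
    then have "\<pi> r \<in> {1..k}" using permutes_in_image[OF \<pi>(1)] by blast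
    then show "(MIN s\<in>{1..k}. (norm (x - D s))\<^sup>2) \<le> (norm (x - D (\<pi> r)))\<^sup>2"
      by (intro Min_le) auto
  qed
  also have "\<dots> = (\<Sum>r\<in>{1..k}. cluster_cost C A r + real (card (A r)) * (norm (D (\<pi> r) - C r))\<^sup>2)"
    unfolding cluster_cost_def
    by (intro sum.cong refl sum_dist_mean stationary_finite[OF st fin] stationary_mean[OF st fin])
  also have "\<dots> = cost X k C + centroidal_dist k A D C"
    by (simp add: sum.distrib cost_eq_sum_cluster_cost[OF st fin] \<pi>(2))
  finally show ?thesis .
qed

lemma borel_measurable_cost:
  fixes D :: "'b \<Rightarrow> nat \<Rightarrow> 'a::euclidean_space"
  assumes "\<And>r. r \<in> {1..k} \<Longrightarrow> (\<lambda>\<omega>. D \<omega> r) \<in> borel_measurable M"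
  shows "(\<lambda>\<omega>. cost X k (D \<omega>)) \<in> borel_measurable M"
proof -
  have "(\<lambda>\<omega>. (norm (x - D \<omega> r))\<^sup>2) \<in> borel_measurable M" if "r \<in> {1..k}" for x r
  proof -
    note [measurable] = assms[OF that]
    show ?thesis by measurable
  qed
  then show ?thesis unfolding cost_def by (intro borel_measurable_sum borel_measurable_Min) auto
qed

lemma borel_measurable_centroidal_dist:
  fixes D :: "'b \<Rightarrow> nat \<Rightarrow> 'a::euclidean_space"
  assumes "\<And>r. r \<in> {1..k} \<Longrightarrow> (\<lambda>\<omega>. D \<omega> r) \<in> borel_measurable M"
  shows "(\<lambda>\<omega>. centroidal_dist k A (D \<omega>) C) \<in> borel_measurable M"
proof -
  have "(\<lambda>\<omega>. real (card (A r)) * (norm (D \<omega> (\<pi> r) - C r))\<^sup>2) \<in> borel_measurable M"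
    if "\<pi> permutes {1..k}" "r \<in> {1..k}" for \<pi> r
  proof -
    have "\<pi> r \<in> {1..k}" using permutes_in_image[OF that(1)] that(2) by blast
    note [measurable] = assms[OF this]
    show ?thesis by measurable
  qed
  then show ?thesis unfolding centroidal_dist_def
    by (intro borel_measurable_Min borel_measurable_sum) (auto simp: finite_permutations)
qed

section \<open>Constants and the seeding event\<close>

lemma p_min_le:
  "r \<in> {1..k} \<Longrightarrow> p_min X k A \<le> real (card (A r)) / real (card X)"
  unfolding p_min_def by (intro Min_le) auto

lemma stationary_k_pos:
  assumes st: "stationary_point X k C A" and fin: "finite X" and ne: "X \<noteq> {}"
  shows "k \<ge> 1"
  using stationary_cover[OF st fin] ne by (cases k) auto

lemma stationary_card_pos:
  assumes st: "stationary_point X k C A" and fin: "finite X" and r: "r \<in> {1..k}"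
  shows "0 < card (A r)" "card (A r) \<le> card X"
  using stationary_nonempty[OF st fin r] stationary_finite[OF st fin, of r]
    stationary_subset[OF st fin, of r] card_mono[OF fin]
  by (auto simp: card_gt_0_iff)

text \<open>The smaller of two disjoint clusters holds at most half of \<open>X\<close>; the bound
  1/2 is used for the logarithm in the condition on \<open>f \<alpha>\<close>.\<close>

lemma p_min_bounds:
  assumes st: "stationary_point X k C A" and fin: "finite X" and ne: "X \<noteq> {}"
  shows "0 < p_min X k A" "p_min X k A \<le> 1" "k \<ge> 2 \<Longrightarrow> p_min X k A \<le> 1 / 2"
proof -
  have k: "k \<ge> 1" using stationary_k_pos[OF assms] .
  have n: "0 < card X" using fin ne by (simp add: card_gt_0_iff)
  let ?S = "(\<lambda>r. real (card (A r)) / real (card X)) ` {1..k}"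
  have "Min ?S \<in> ?S" using k by (intro Min_in) auto
  then show "0 < p_min X k A"
    unfolding p_min_def using stationary_card_pos[OF st fin] n by auto
  have "p_min X k A \<le> real (card (A 1)) / real (card X)" using k by (intro p_min_le) auto
  also have "\<dots> \<le> 1" using stationary_card_pos(2)[OF st fin, of 1] k n by simp
  finally show "p_min X k A \<le> 1" .
  assume k2: "k \<ge> 2"
  have "card (A 1) + card (A 2) = card (A 1 \<union> A 2)"
    using stationary_finite[OF st fin] stationary_disjoint[OF st fin, of 1 2]
    by (simp add: card_Un_disjoint)
  also have "\<dots> \<le> card X" using stationary_subset[OF st fin] by (intro card_mono fin) auto
  finally have "real (card (A 1)) / real (card X) + real (card (A 2)) / real (card X) \<le> 1"
    using n by (simp flip: add_divide_distrib of_nat_add)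
  moreover have "p_min X k A \<le> real (card (A 1)) / real (card X)"
    "p_min X k A \<le> real (card (A 2)) / real (card X)"
    using k2 by (auto intro!: p_min_le)
  ultimately show "p_min X k A \<le> 1 / 2" by linarith
qed

lemma w_min_nonneg:
  assumes st: "stationary_point X k C A" and fin: "finite X" and k: "k \<ge> 1"
  shows "0 \<le> w_min k C A"
proof -
  have "0 \<le> w_coeff C A r" if r: "r \<in> {1..k}" for r
  proof -
    obtain x where x: "x \<in> A r" using stationary_nonempty[OF st fin r] by blast
    have "0 \<le> (norm (x - C r))\<^sup>2" by simp
    also have "\<dots> \<le> (MAX x\<in>A r. (norm (x - C r))\<^sup>2)"
      using stationary_finite[OF st fin] x by (intro Max_ge) auto
    finally show ?thesis unfolding w_coeff_def cluster_cost_def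
      by (intro divide_nonneg_nonneg sum_nonneg) auto
  qed
  then show ?thesis unfolding w_min_def using k by simp
qed

lemma power_one_minus_le_exp:
  fixes p q :: real
  assumes "p \<le> q" "q \<le> 1"
  shows "(1 - q) ^ m \<le> exp (- (real m * p))"
proof -
  have "(1 - q) ^ m \<le> exp (- p) ^ m"
    using assms exp_ge_add_one_self[of "- p"] by (intro power_mono) auto
  then show ?thesis by (simp flip: exp_of_nat_mult)
qed

context iid_sampling
begin

text \<open>Union bound over the clusters that may be missed.\<close>

lemma measure_all_clusters_hit:
  assumes "finite R" and A: "\<And>r. r \<in> R \<Longrightarrow> A r \<subseteq> X"
  shows "1 - (\<Sum>r\<in>R. (1 - real (card (A r)) / real (card X)) ^ m)
    \<le> measure (iid_batch X m) {z \<in> space (iid_batch X m). \<forall>r\<in>R. \<exists>j<m. z j \<in> A r}"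
    (is "_ \<le> measure ?N ?G")
proof -
  interpret prob_space ?N by (rule prob_space_batch)
  let ?miss = "\<lambda>r. {z \<in> space ?N. \<forall>j<m. z j \<notin> A r}"
  have meas: "S \<in> sets ?N" if "S \<subseteq> space ?N" for S using that sets_batch by blast
  have compl: "space ?N - ?G = (\<Union>r\<in>R. ?miss r)" by blast
  have "?miss ` R \<subseteq> sets ?N" by (intro image_subsetI meas Collect_restrict)
  from finite_measure_subadditive_finite[OF \<open>finite R\<close> this]
  have "measure ?N (space ?N - ?G) \<le> (\<Sum>r\<in>R. measure ?N (?miss r))"
    unfolding compl .
  moreover have "measure ?N (space ?N - ?G) = 1 - measure ?N ?G"
    by (rule prob_compl) (intro meas Collect_restrict)
  moreover have "(\<Sum>r\<in>R. measure ?N (?miss r)) = (\<Sum>r\<in>R. (1 - real (card (A r)) / real (card X)) ^ m)"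
    by (intro sum.cong refl measure_batch_miss A)
  ultimately show ?thesis by linarith
qed

lemma sample_space_eq:
  "sample_space X m\<^sub>o m = iid_batch X m\<^sub>o \<Otimes>\<^sub>M (\<Pi>\<^sub>M t\<in>{1..}. iid_batch X m)"
  by (simp add: sample_space_def)

lemma prob_space_batches: "prob_space (\<Pi>\<^sub>M t\<in>{1..}. iid_batch X m)"
  by (intro prob_space_PiM prob_space_batch)

lemma prob_space_sample_space: "prob_space (sample_space X m\<^sub>o m)"
  unfolding sample_space_eq by (intro prob_space_pair prob_space_batch prob_space_batches)

lemma sample_spaceD:
  assumes "\<omega> \<in> space (sample_space X m\<^sub>o m)"
  shows "j < m\<^sub>o \<Longrightarrow> fst \<omega> j \<in> X" "t \<ge> 1 \<Longrightarrow> j < m \<Longrightarrow> snd \<omega> t j \<in> X"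
  using assms unfolding sample_space_eq
  by (auto simp: space_pair_measure space_PiM space_uniform_count_measure PiE_iff)

text \<open>A condition on the seeding component only, hence a rectangle in the product:
  conditioning on it leaves the law of the batches untouched.\<close>

definition seeding_hits :: "nat \<Rightarrow> (nat \<Rightarrow> 'a set) \<Rightarrow> nat \<Rightarrow> nat \<Rightarrow> 'a sample set" where
  "seeding_hits k A m\<^sub>o m =
     {\<omega> \<in> space (sample_space X m\<^sub>o m). \<forall>r\<in>{1..k}. \<exists>j<m\<^sub>o. fst \<omega> j \<in> A r}"

lemma seeding_hits_measure:
  shows "seeding_hits k A m\<^sub>o m \<in> sets (sample_space X m\<^sub>o m)"
    and "measure (sample_space X m\<^sub>o m) (seeding_hits k A m\<^sub>o m) =
      measure (iid_batch X m\<^sub>o) {z \<in> space (iid_batch X m\<^sub>o). \<forall>r\<in>{1..k}. \<exists>j<m\<^sub>o. z j \<in> A r}"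
proof -
  let ?P = "\<Pi>\<^sub>M t\<in>{1..}. iid_batch X m"
  let ?G = "{z \<in> space (iid_batch X m\<^sub>o). \<forall>r\<in>{1..k}. \<exists>j<m\<^sub>o. z j \<in> A r}"
  interpret P: prob_space ?P by (rule prob_space_batches)
  have eq: "seeding_hits k A m\<^sub>o m = ?G \<times> space ?P"
    unfolding seeding_hits_def sample_space_eq space_pair_measure by auto
  have G: "?G \<in> sets (iid_batch X m\<^sub>o)" unfolding sets_batch by blast
  show "seeding_hits k A m\<^sub>o m \<in> sets (sample_space X m\<^sub>o m)"
    unfolding eq sample_space_eq by (rule pair_measureI[OF G sets.top])
  show "measure (sample_space X m\<^sub>o m) (seeding_hits k A m\<^sub>o m) = measure (iid_batch X m\<^sub>o) ?G"
    unfolding eq sample_space_eq measure_def P.emeasure_pair_measure_Times[OF G sets.top]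
      P.emeasure_space_1 by simp
qed

end

section \<open>Conditional expectations and the final bound\<close>

text \<open>The bound \<open>b\<close> makes both set integrals exist. All estimates are asked for
  on \<open>G\<close> only, where the hull argument controls the centroids.\<close>

lemma expectation_given_diff_le:
  assumes "prob_space M" and G: "G \<in> sets M" "0 < measure M G"
    and [measurable]: "Y \<in> borel_measurable M" "Z \<in> borel_measurable M"
    and Y: "\<And>\<omega>. \<omega> \<in> G \<Longrightarrow> 0 \<le> Y \<omega>" "\<And>\<omega>. \<omega> \<in> G \<Longrightarrow> Y \<omega> \<le> a + Z \<omega>"
    and Z: "\<And>\<omega>. \<omega> \<in> G \<Longrightarrow> 0 \<le> Z \<omega>" "\<And>\<omega>. \<omega> \<in> G \<Longrightarrow> Z \<omega> \<le> b"
  shows "expectation_given M Y G - a \<le> expectation_given M Z G"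
proof -
  interpret prob_space M by fact
  note [measurable] = G(1)
  have "\<bar>Z \<omega>\<bar> \<le> \<bar>b\<bar>" if "\<omega> \<in> G" for \<omega>
    using Z[OF that] by linarith
  then have intZ: "set_integrable M G Z"
    unfolding set_integrable_def
    by (intro integrable_const_bound[of _ "\<bar>b\<bar>"]) (auto simp: indicator_def)
  have "\<bar>Y \<omega>\<bar> \<le> \<bar>a + b\<bar>" if "\<omega> \<in> G" for \<omega>
    using Y[OF that] Z[OF that] by linarith
  then have intY: "set_integrable M G Y"
    unfolding set_integrable_def
    by (intro integrable_const_bound[of _ "\<bar>a + b\<bar>"]) (auto simp: indicator_def)
  have inta: "set_integrable M G (\<lambda>_. a)"
    unfolding set_integrable_def
    by (intro integrable_const_bound[of _ "\<bar>a\<bar>"]) (auto simp: indicator_def)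
  have "(LINT \<omega>:G|M. Y \<omega>) \<le> (LINT \<omega>:G|M. a + Z \<omega>)"
    using Y(2) by (intro set_integral_mono intY set_integral_add inta intZ) auto
  also have "\<dots> = a * measure M G + (LINT \<omega>:G|M. Z \<omega>)"
  proof -
    have "(LINT \<omega>:G|M. a) = a * measure M G"
      using G(1) by (simp add: set_lebesgue_integral_def mult.commute sets.Int_space_eq2)
    then show ?thesis using set_integral_add(2)[OF inta intZ] by simp
  qed
  finally have "(LINT \<omega>:G|M. Y \<omega>) / measure M G
      \<le> (a * measure M G + (LINT \<omega>:G|M. Z \<omega>)) / measure M G"
    using G(2) by (intro divide_right_mono) auto
  then show ?thesis
    using G(2) by (simp add: expectation_given_def add_divide_distrib)
qed

text \<open>The bridge from the nonnegative integrals of the recursion to the Bochner integral in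
  \<open>expectation_given\<close>.\<close>

lemma expectation_given_le:
  assumes [measurable]: "G \<in> sets M" "Z \<in> borel_measurable M" and pos: "0 < measure M G"
    and Z: "\<And>\<omega>. 0 \<le> Z \<omega>" and b: "0 \<le> b"
    and le: "(\<integral>\<^sup>+\<omega>. ennreal (Z \<omega>) * indicator G \<omega> \<partial>M) \<le> ennreal b"
  shows "expectation_given M Z G \<le> b / measure M G"
proof -
  have "(LINT \<omega>:G|M. Z \<omega>) = enn2real (\<integral>\<^sup>+\<omega>. ennreal (indicator G \<omega> * Z \<omega>) \<partial>M)"
    unfolding set_lebesgue_integral_def real_scaleR_def using Z
    by (intro integral_eq_nn_integral) auto
  also have "(\<lambda>\<omega>. ennreal (indicator G \<omega> * Z \<omega>)) = (\<lambda>\<omega>. ennreal (Z \<omega>) * indicator G \<omega>)"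
    by (auto simp: indicator_def)
  also have "enn2real (\<integral>\<^sup>+\<omega>. ennreal (Z \<omega>) * indicator G \<omega> \<partial>M) \<le> b"
    using le b by (rule enn2real_leI[rotated])
  finally show ?thesis
    using pos by (simp add: expectation_given_def divide_right_mono)
qed

context iid_sampling
begin

lemma borel_measurable_cluster_path:
  "(\<lambda>S. cluster_path B m \<eta> c S t) \<in> borel_measurable (\<Pi>\<^sub>M t\<in>{1..}. iid_batch X m)"
proof -
  have "(\<lambda>S. restrict S {1..t}) \<in> (\<Pi>\<^sub>M t\<in>{1..}. iid_batch X m) \<rightarrow>\<^sub>M (\<Pi>\<^sub>M t\<in>{1..t}. iid_batch X m)"
    by (rule measurable_restrict_subset) auto
  from measurable_compose[OF this measurable_batches[of _ "\<lambda>S. cluster_path B m \<eta> c S t"]]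
  have "(\<lambda>S. cluster_path B m \<eta> c (restrict S {1..t}) t) \<in> borel_measurable (\<Pi>\<^sub>M t\<in>{1..}. iid_batch X m)"
    by simp
  moreover have "cluster_path B m \<eta> c (restrict S {1..t}) t = cluster_path B m \<eta> c S t" for S
    by (rule cluster_path_cong) auto
  ultimately show ?thesis by simp
qed

text \<open>The permutation that matches centroids to clusters depends on the sample point, but the
  right-hand side is free of it and can be integrated.\<close>

lemma centroidal_dist_path_le:
  assumes sep: "separated_clustering X k A \<rho>"
    and km: "stochastic_kmeans X k m\<^sub>o m (\<lambda>t r. \<eta> t) C"
    and \<eta>: "\<And>t. 0 \<le> \<eta> t" "\<And>t. \<eta> t \<le> 1"
    and \<omega>: "\<omega> \<in> seeding_hits k A m\<^sub>o m"
  shows "centroidal_dist k A (C t \<omega>) Cs \<le> (\<Sum>r\<in>{1..k}. real (card (A r)) *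
    (norm (cluster_path (A r) m \<eta> (mean_of {j. j < m\<^sub>o \<and> fst \<omega> j \<in> A r} (fst \<omega>)) (snd \<omega>) t - Cs r))\<^sup>2)"
proof -
  interpret separated_clustering X k A \<rho> by fact
  have sp: "\<omega> \<in> space (sample_space X m\<^sub>o m)"
    and hit: "\<And>r. r \<in> {1..k} \<Longrightarrow> \<exists>j<m\<^sub>o. fst \<omega> j \<in> A r"
    using \<omega> unfolding seeding_hits_def by auto
  have b: "buckshot k m\<^sub>o (fst \<omega>) (C 0 \<omega>)"
    and step: "\<And>t. t \<ge> 1 \<Longrightarrow> kmeans_step k m (\<lambda>_. \<eta> t) (C (t - 1) \<omega>) (snd \<omega> t) (C t \<omega>)"
    using km sp unfolding stochastic_kmeans_def by auto
  obtain \<pi> where \<pi>: "\<pi> permutes {1..k}"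
    and path: "\<And>t r. r \<in> {1..k} \<Longrightarrow> C t \<omega> (\<pi> r) =
      cluster_path (A r) m \<eta> (mean_of {j. j < m\<^sub>o \<and> fst \<omega> j \<in> A r} (fst \<omega>)) (snd \<omega>) t"
    using stochastic_kmeans_recovers[where C = "\<lambda>t. C t \<omega>", OF b sample_spaceD(1)[OF sp] hit step
        sample_spaceD(2)[OF sp] \<eta>] by blast
  show ?thesis using centroidal_dist_le[OF \<pi>, of A "C t \<omega>" Cs] path by simp
qed

text \<open>Tonelli with the seeding held fixed: each starting centroid is then a constant in the
  hull of its cluster, and the single-cluster bound applies with a constant independent of the
  seeding. The second claim supplies the boundedness on which integrability rests.\<close>

lemma nn_integral_centroidal_dist:
  assumes sep: "separated_clustering X k A \<rho>" and st: "stationary_point X k Cs A"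
    and km: "stochastic_kmeans X k m\<^sub>o m (\<lambda>t r. \<eta> t) C"
    and \<eta>: "\<And>t. \<eta> t = c' / (real t + t\<^sub>o)" and c': "0 < c'" "c' \<le> t\<^sub>o" and t\<^sub>o: "1 < t\<^sub>o"
    and q: "\<And>r. r \<in> {1..k} \<Longrightarrow> 1 \<le> c' * (1 - (1 - real (card (A r)) / real (card X)) ^ m)"
    and K: "K = max (\<rho>\<^sup>2 * t\<^sub>o) (2 * c'\<^sup>2 * \<rho>\<^sup>2)"
  shows "(\<integral>\<^sup>+\<omega>. ennreal (centroidal_dist k A (C t \<omega>) Cs) * indicator (seeding_hits k A m\<^sub>o m) \<omega>
      \<partial>sample_space X m\<^sub>o m) \<le> ennreal ((\<Sum>r\<in>{1..k}. real (card (A r)) * K) / (real t + t\<^sub>o))"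
    and "\<And>\<omega>. \<omega> \<in> seeding_hits k A m\<^sub>o m \<Longrightarrow>
      centroidal_dist k A (C t \<omega>) Cs \<le> (\<Sum>r\<in>{1..k}. real (card (A r)) * \<rho>\<^sup>2)"
proof -
  interpret sep: separated_clustering X k A \<rho> by fact
  have \<eta>01: "0 \<le> \<eta> t" "\<eta> t \<le> 1" for t using c' t\<^sub>o by (auto simp: \<eta> divide_le_eq)
  let ?G = "seeding_hits k A m\<^sub>o m"
  let ?P = "\<Pi>\<^sub>M t\<in>{1..}. iid_batch X m"
  let ?c = "\<lambda>r z. mean_of {j. j < m\<^sub>o \<and> z j \<in> A r} z"
  let ?d = "\<lambda>r z S. (norm (cluster_path (A r) m \<eta> (?c r z) S t - Cs r))\<^sup>2"
  have c_hull: "?c r z \<in> convex hull (A r)" if "\<exists>j<m\<^sub>o. z j \<in> A r" for r z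
    using that by (intro mean_of_in_hull) auto
  have mean_hull: "Cs r \<in> convex hull (A r)" if r: "r \<in> {1..k}" for r
    unfolding stationary_mean[OF st finite_X r]
    using stationary_finite[OF st finite_X] stationary_nonempty[OF st finite_X r]
    by (intro mean_of_in_hull) auto
  \<comment> \<open>The mean lies in the hull of its cluster, so the diameter bound
    \<open>\<rho>\<close> also serves as the radius \<open>M\<close>.\<close>
  have radius: "norm (x - Cs r) \<le> \<rho>" if "r \<in> {1..k}" "x \<in> A r" for r x
    using sep.near_hull[OF that mean_hull[OF that(1)]] by (simp add: dist_norm)
  show bound: "centroidal_dist k A (C t \<omega>) Cs \<le> (\<Sum>r\<in>{1..k}. real (card (A r)) * \<rho>\<^sup>2)"
    if \<omega>: "\<omega> \<in> ?G" for \<omega>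
  proof -
    have "?d r (fst \<omega>) (snd \<omega>) \<le> \<rho>\<^sup>2" if r: "r \<in> {1..k}" for r
    proof -
      have "cluster_path (A r) m \<eta> (?c r (fst \<omega>)) (snd \<omega>) t \<in> convex hull (A r)"
        using \<omega> r c_hull \<eta>01 by (intro cluster_path_in_hull) (auto simp: seeding_hits_def)
      moreover have "convex hull (A r) \<subseteq> cball (Cs r) \<rho>"
        using radius[OF r] by (intro hull_minimal) (auto simp: dist_norm norm_minus_commute)
      ultimately have "norm (cluster_path (A r) m \<eta> (?c r (fst \<omega>)) (snd \<omega>) t - Cs r) \<le> \<rho>"
        by (auto simp: dist_norm norm_minus_commute)
      then show ?thesis by (intro power_mono) auto
    qed
    then have "(\<Sum>r\<in>{1..k}. real (card (A r)) * ?d r (fst \<omega>) (snd \<omega>))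
        \<le> (\<Sum>r\<in>{1..k}. real (card (A r)) * \<rho>\<^sup>2)"
      by (intro sum_mono mult_left_mono) auto
    then show ?thesis using centroidal_dist_path_le[OF sep km \<eta>01 \<omega>, of t Cs] by linarith
  qed
  interpret P: prob_space ?P by (rule prob_space_batches)
  let ?f = "\<lambda>\<omega>. ennreal (centroidal_dist k A (C t \<omega>) Cs) * indicator ?G \<omega>"
  have "(\<lambda>\<omega>. centroidal_dist k A (C t \<omega>) Cs) \<in> borel_measurable (sample_space X m\<^sub>o m)"
    using km unfolding stochastic_kmeans_def by (intro borel_measurable_centroidal_dist) auto
  then have f: "?f \<in> borel_measurable (sample_space X m\<^sub>o m)"
    using seeding_hits_measure(1) by (intro borel_measurable_times_ennreal) auto
  have K0: "0 \<le> K" unfolding K by (simp add: le_max_iff_disj)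
  have inner: "(\<integral>\<^sup>+S. ?f (z, S) \<partial>?P) \<le> ennreal ((\<Sum>r\<in>{1..k}. real (card (A r)) * K) / (real t + t\<^sub>o))"
    (is "_ \<le> ?b") if z: "z \<in> space (iid_batch X m\<^sub>o)" for z
  proof (cases "\<forall>r\<in>{1..k}. \<exists>j<m\<^sub>o. z j \<in> A r")
    \<comment> \<open>A seeding that misses a cluster makes the indicator vanish for every batch
      sequence.\<close>
    case False
    then have "(z, S) \<notin> ?G" for S by (simp add: seeding_hits_def)
    then have "?f (z, S) = 0" for S by simp
    then show ?thesis by (simp only: nn_integral_const mult_zero_left zero_le)
  next
    case True
    have "?f (z, S) \<le> (\<Sum>r\<in>{1..k}. ennreal (real (card (A r))) * ennreal (?d r z S))"
      if S: "S \<in> space ?P" for S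
    proof -
      have G: "(z, S) \<in> ?G"
        using z S True unfolding seeding_hits_def sample_space_eq by (simp add: space_pair_measure)
      then have "?f (z, S) \<le> ennreal (\<Sum>r\<in>{1..k}. real (card (A r)) * ?d r z S)"
        using centroidal_dist_path_le[OF sep km \<eta>01 G, of t Cs] by (simp add: ennreal_leI)
      then show ?thesis by (simp add: sum_ennreal flip: ennreal_mult)
    qed
    then have "(\<integral>\<^sup>+S. ?f (z, S) \<partial>?P)
        \<le> (\<integral>\<^sup>+S. (\<Sum>r\<in>{1..k}. ennreal (real (card (A r))) * ennreal (?d r z S)) \<partial>?P)"
      by (rule nn_integral_mono)
    also have "\<dots> = (\<Sum>r\<in>{1..k}. ennreal (real (card (A r))) * (\<integral>\<^sup>+S. ennreal (?d r z S) \<partial>?P))"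
    proof -
      have "(\<lambda>S. ennreal (?d r z S)) \<in> borel_measurable ?P" for r
        by (rule measurable_compose[OF borel_measurable_cluster_path]) measurable
      note meas = this
      have "(\<integral>\<^sup>+S. (\<Sum>r\<in>{1..k}. ennreal (real (card (A r))) * ennreal (?d r z S)) \<partial>?P)
          = (\<Sum>r\<in>{1..k}. \<integral>\<^sup>+S. ennreal (real (card (A r))) * ennreal (?d r z S) \<partial>?P)"
        by (intro nn_integral_sum borel_measurable_times_ennreal borel_measurable_const meas)
      then show ?thesis unfolding nn_integral_cmult[OF meas] .
    qed
    also have "\<dots> \<le> (\<Sum>r\<in>{1..k}. ennreal (real (card (A r))) * ennreal (K / (real t + t\<^sub>o)))"
    proof (intro sum_mono mult_left_mono)
      fix r assume r: "r \<in> {1..k}"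
      show "(\<integral>\<^sup>+S. ennreal (?d r z S) \<partial>?P) \<le> ennreal (K / (real t + t\<^sub>o))"
        using True r
        by (intro nn_integral_cluster_path[OF stationary_subset[OF st finite_X]
              stationary_mean[OF st finite_X r] radius[OF r] c_hull \<eta> c' t\<^sub>o q[OF r]])
          (auto simp: K)
    qed simp
    also have "\<dots> = ?b"
      using K0 t\<^sub>o by (simp add: sum_ennreal sum_divide_distrib flip: ennreal_mult)
    finally show ?thesis .
  qed
  have "(\<integral>\<^sup>+\<omega>. ?f \<omega> \<partial>sample_space X m\<^sub>o m) = (\<integral>\<^sup>+z. (\<integral>\<^sup>+S. ?f (z, S) \<partial>?P) \<partial>iid_batch X m\<^sub>o)"
    using P.nn_integral_fst[of ?f "iid_batch X m\<^sub>o"] f unfolding sample_space_eq by simp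
  also have "\<dots> \<le> (\<integral>\<^sup>+z. ennreal ((\<Sum>r\<in>{1..k}. real (card (A r)) * K) / (real t + t\<^sub>o)) \<partial>iid_batch X m\<^sub>o)"
    using inner by (rule nn_integral_mono)
  also have "\<dots> = ennreal ((\<Sum>r\<in>{1..k}. real (card (A r)) * K) / (real t + t\<^sub>o))"
    using prob_space.emeasure_space_1[OF prob_space_batch] by (simp only: nn_integral_const mult_1_right)
  finally show "(\<integral>\<^sup>+\<omega>. ?f \<omega> \<partial>sample_space X m\<^sub>o m)
      \<le> ennreal ((\<Sum>r\<in>{1..k}. real (card (A r)) * K) / (real t + t\<^sub>o))" .
qed

text \<open>Each cluster is missed with probability at most exp(-m_o p_min), hence at most \<xi> /
  (2 k) by the lower bound on \<open>m\<^sub>o\<close>; the \<open>k\<close> clusters together cost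
  \<xi> / 2.\<close>

lemma seeding_hits_prob_ge:
  assumes st: "stationary_point X k C A" and \<xi>: "0 < \<xi>"
    and m: "ln (2 * real k / \<xi>) / p_min X k A < real m\<^sub>o"
  shows "1 - \<xi> / 2 \<le> measure (sample_space X m\<^sub>o m) (seeding_hits k A m\<^sub>o m)"
proof -
  have k: "k \<ge> 1" using stationary_k_pos[OF st finite_X nonempty_X] .
  note p = p_min_bounds[OF st finite_X nonempty_X]
  have n: "0 < card X" using finite_X nonempty_X by (simp add: card_gt_0_iff)
  have "(1 - real (card (A r)) / real (card X)) ^ m\<^sub>o \<le> \<xi> / (2 * real k)" if r: "r \<in> {1..k}" for r
  proof -
    have "(1 - real (card (A r)) / real (card X)) ^ m\<^sub>o \<le> exp (- (real m\<^sub>o * p_min X k A))"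
      using p_min_le[OF r] stationary_card_pos(2)[OF st finite_X r] n
      by (intro power_one_minus_le_exp) auto
    also have "\<dots> \<le> exp (- ln (2 * real k / \<xi>))"
      using m p(1) by (simp add: pos_divide_less_eq)
    also have "\<dots> = \<xi> / (2 * real k)"
      using k \<xi> by (simp add: exp_minus)
    finally show ?thesis .
  qed
  then have "(\<Sum>r\<in>{1..k}. (1 - real (card (A r)) / real (card X)) ^ m\<^sub>o)
      \<le> real (card {1..k}) * (\<xi> / (2 * real k))"
    by (rule sum_bounded_above)
  also have "\<dots> = \<xi> / 2" using k by simp
  finally show ?thesis
    using measure_all_clusters_hit[of "{1..k}" A m\<^sub>o] stationary_subset[OF st finite_X]
    unfolding seeding_hits_measure(2) by fastforce
qed

end

text \<open>Reduces the lower bound on \<open>f \<alpha>\<close> to 5 / sqrt (2 w_min). Both 2 k /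
  \<xi> and 2 / (\<xi> p) are at least 4, above e, so the inner logarithm is at least 1 and then so
  is the outer one.\<close>

lemma one_le_ln_margin_factor:
  fixes \<xi> p :: real
  assumes \<xi>: "0 < \<xi>" "\<xi> < 1" and p: "0 < p" "p \<le> 1 / 2" and k: "k \<ge> 2"
  shows "1 \<le> ln (2 / (\<xi> * p) * ln (2 * real k / \<xi>))"
proof -
  have "exp 1 * \<xi> \<le> 3 * 1" using \<xi> exp_le by (intro mult_mono) auto
  then have "exp 1 \<le> 2 * real k / \<xi>" using \<xi> k by (simp add: pos_le_divide_eq)
  then have 1: "1 \<le> ln (2 * real k / \<xi>)" using \<xi> k by (simp add: ln_ge_iff)
  have "\<xi> * p \<le> 1 * (1 / 2)" using \<xi> p by (intro mult_mono) auto
  then have "4 \<le> 2 / (\<xi> * p)" using \<xi> p by (simp add: pos_le_divide_eq)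
  then have "4 * 1 \<le> 2 / (\<xi> * p) * ln (2 * real k / \<xi>)" using 1 \<xi> p
    by (intro mult_mono) auto
  then have "exp 1 \<le> 2 / (\<xi> * p) * ln (2 * real k / \<xi>)" using exp_le by linarith
  then show ?thesis using ln_ge_iff less_le_trans[OF exp_gt_zero] by blast
qed

text \<open>If \<open>w_min\<close> were 0, the upper bound would force m_o < \<xi> / 2 < 1 while
  the lower one forces m_o > 0: no integer is left.\<close>

lemma w_min_pos:
  assumes st: "stationary_point X k C A" and fin: "finite X" and ne: "X \<noteq> {}"
    and \<xi>: "0 < \<xi>" "\<xi> < 1"
    and lower: "ln (2 * real k / \<xi>) / p_min X k A < real m\<^sub>o"
    and upper: "real m\<^sub>o < \<xi> / 2 * exp (2 * s\<^sup>2 * (w_min k C A)\<^sup>2)"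
  shows "0 < w_min k C A"
proof (rule ccontr)
  assume "\<not> 0 < w_min k C A"
  then have "w_min k C A = 0"
    using w_min_nonneg[OF st fin stationary_k_pos[OF st fin ne]] by linarith
  then have "real m\<^sub>o < 1" using upper \<xi> by simp
  moreover have "0 < real m\<^sub>o"
  proof -
    have "1 < 2 * real k / \<xi>" using stationary_k_pos[OF st fin ne] \<xi> by (simp add: less_divide_eq)
    then have "0 < ln (2 * real k / \<xi>) / p_min X k A"
      using p_min_bounds(1)[OF st fin ne] by simp
    then show ?thesis using lower by linarith
  qed
  ultimately show False by simp
qed

text \<open>\<open>K\<close> is chosen before \<open>t\<close>, the uniformity that O(1/t) asks for.
  Positivity of the bracket in the bound on \<open>c'\<close> is a separate assumption because the
  bound on \<open>m\<close> controls (1 - 4/5 p)^m, which is at most exp(- 4/5 m p), so it does not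
  imply it.\<close>

theorem theorem2:
  fixes X :: "(real ^ 'd) set" and k m\<^sub>o m :: nat
    and Cs :: "nat \<Rightarrow> real ^ 'd" and As :: "nat \<Rightarrow> (real ^ 'd) set"
    and f :: "real \<Rightarrow> real" and \<alpha> \<xi> \<beta> \<delta> c' t\<^sub>o :: real
    and C :: "nat \<Rightarrow> (real ^ 'd) sample \<Rightarrow> nat \<Rightarrow> real ^ 'd"
  assumes "0 < \<alpha>" "\<alpha> < 1" and "0 < \<xi>"
    and "finite X" and "X \<noteq> {}"
    and "clusterable f \<alpha> X k Cs As"
    and "f \<alpha> \<ge> 5 * sqrt (1 / (2 * w_min k Cs As) *
           ln (2 / (\<xi> * p_min X k As) * ln (2 * real k / \<xi>)))"
    and "\<beta> \<ge> 2" and "0 < \<delta>" "\<delta> < 1 / exp 1"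
    and "ln (2 * real k / \<xi>) / p_min X k As < real m\<^sub>o"
    and "real m\<^sub>o < \<xi> / 2 * exp (2 * (f \<alpha> / 4 - 1)\<^sup>2 * (w_min k Cs As)\<^sup>2)"
    and "real m > ln (1 - sqrt \<alpha>) / ln (1 - 4 / 5 * p_min X k As)"
    and "1 - sqrt \<alpha> - exp (- (4 / 5 * real m * p_min X k As)) > 0"
    and "c' > \<beta> / (2 * (1 - sqrt \<alpha> - exp (- (4 / 5 * real m * p_min X k As))))"
    and "t\<^sub>o \<ge> 867 * c'\<^sup>2 * (real (card X))\<^sup>2 * (ln (1 / \<delta>))\<^sup>2"
    and "stochastic_kmeans X k m\<^sub>o m (\<lambda>t r. c' / (real t + t\<^sub>o)) C"
  shows "\<exists>K::real. \<forall>t\<ge>1. \<exists>G \<in> sets (sample_space X m\<^sub>o m).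
           measure (sample_space X m\<^sub>o m) G \<ge> (1 - \<delta>) * (1 - \<xi>) \<and>
           expectation_given (sample_space X m\<^sub>o m) (\<lambda>\<omega>. cost X k (C t \<omega>)) G - cost X k Cs
             \<le> expectation_given (sample_space X m\<^sub>o m)
                  (\<lambda>\<omega>. centroidal_dist k As (C t \<omega>) Cs) G \<and>
           expectation_given (sample_space X m\<^sub>o m)
             (\<lambda>\<omega>. centroidal_dist k As (C t \<omega>) Cs) G \<le> K / real t"
proof (cases "\<xi> < 1")
  \<comment> \<open>For \<xi> at least 1 the required probability is at most 0 and the empty event
    serves; its conditional expectations evaluate to 0 / 0 = 0.\<close>
  case False
  have "0 \<le> cost X k Cs" unfolding cost_def
  proof (intro sum_nonneg)
    fix x assume "x \<in> X"
    have "k \<ge> 1"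
      using assms(4-6) stationary_k_pos unfolding clusterable_def by blast
    then show "0 \<le> (MIN r\<in>{1..k}. (norm (x - Cs r))\<^sup>2)" by simp
  qed
  moreover have "\<delta> \<le> 1"
    using assms(10) by (rule order_trans[OF less_imp_le]) simp
  ultimately show ?thesis
    using False
    by (intro exI[of _ 0] allI impI bexI[of _ "{}"])
      (auto simp: expectation_given_def mult_le_0_iff set_lebesgue_integral_def)
next
  case True
  interpret iid_sampling X using assms(4,5) by unfold_locales
  let ?S = "sample_space X m\<^sub>o m" and ?G = "seeding_hits k As m\<^sub>o m"
  let ?D = "\<lambda>t \<omega>. centroidal_dist k As (C t \<omega>) Cs"
  define \<eta> where "\<eta> t = c' / (real t + t\<^sub>o)" for t :: nat
  have st: "stationary_point X k Cs As" using assms(6) unfolding clusterable_def by blast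
  note fin = assms(4) and ne = assms(5)
  note p = p_min_bounds[OF st fin ne]
  have w: "0 < w_min k Cs As"
    using w_min_pos[OF st fin ne assms(3) True assms(11,12)] .
  obtain \<rho> where sep: "separated_clustering X k As \<rho>"
    using clusterable_imp_separated[OF fin assms(6) w assms(7)]
      one_le_ln_margin_factor[OF assms(3) True p(1,3)] by blast
  \<comment> \<open>The bracket of the condition on \<open>c'\<close> bounds from below, for all
    clusters at once, the probability that a batch meets the cluster.\<close>
  define q where "q = 1 - sqrt \<alpha> - exp (- (4 / 5 * real m * p_min X k As))"
  have q: "0 < q" "q < 1" 
    using assms(14) real_sqrt_gt_zero[OF assms(1)]
      exp_gt_zero[of "- (4 / 5 * real m * p_min X k As)"]
    unfolding q_def by linarith+
  have c'q: "1 < c' * q"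
  proof -
    \<comment> \<open>\<open>\<beta> \<ge> 2\<close> cancels the 2 in the denominator, so
      \<open>c'\<close> exceeds 1 / q.\<close>
    have "1 / q \<le> \<beta> / (2 * q)" using assms(8) q by (simp add: field_simps)
    also have "\<dots> < c'" using assms(15) by (simp add: q_def)
    finally show ?thesis using q by (simp add: field_simps)
  qed
  then have c'1: "1 < c'" 
  proof -
    have "0 < c' * q" using c'q by linarith
    then have "0 < c'" using q(1) by (rule zero_less_mult_pos2)
    then have "c' * q < c' * 1" using q(2) by (rule mult_strict_left_mono[rotated])
    then show ?thesis using c'q by simp
  qed
  \<comment> \<open>All factors beside \<open>c'\<^sup>2\<close> are at least 1, the logarithm
    because \<delta> < 1/e, and \<open>c'\<^sup>2\<close> is at least \<open>c'\<close>. This keeps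
    the learning rates at most 1.\<close>
  have to: "c' \<le> t\<^sub>o"
  proof -
    have n: "1 \<le> real (card X)" using fin ne by (simp add: Suc_le_eq card_gt_0_iff)
    have "1 \<le> ln (1 / \<delta>)"
    proof -
      have "exp 1 \<le> 1 / \<delta>" using assms(9,10) by (simp add: field_simps)
      then show ?thesis using assms(9) by (simp add: ln_ge_iff)
    qed
    then have "1 * 1 \<le> (real (card X))\<^sup>2 * (ln (1 / \<delta>))\<^sup>2"
      using n by (intro mult_mono one_le_power) auto
    then have "c'\<^sup>2 * 1 \<le> 867 * c'\<^sup>2 * ((real (card X))\<^sup>2 * (ln (1 / \<delta>))\<^sup>2)"
      by (intro mult_mono) auto
    moreover have "c' * 1 \<le> c'\<^sup>2"
      unfolding power2_eq_square using c'1 by (intro mult_left_mono) auto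
    ultimately show ?thesis using assms(16) by (simp add: mult.assoc)
  qed
  have hit: "1 \<le> c' * (1 - (1 - real (card (As r)) / real (card X)) ^ m)" if r: "r \<in> {1..k}" for r
  proof -
    have "(1 - real (card (As r)) / real (card X)) ^ m \<le> exp (- (real m * p_min X k As))"
      using p_min_le[OF r] stationary_card_pos(2)[OF st fin r] 
      by (intro power_one_minus_le_exp) (auto simp: divide_le_eq)
    also have "\<dots> \<le> exp (- (4 / 5 * real m * p_min X k As))"
      using p(1) by (simp add: mult_right_mono)
    finally have "q \<le> 1 - (1 - real (card (As r)) / real (card X)) ^ m"
      using real_sqrt_gt_zero[OF assms(1)] unfolding q_def by linarith
    then have "c' * q \<le> c' * (1 - (1 - real (card (As r)) / real (card X)) ^ m)"
      using c'1 by (intro mult_left_mono) auto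
    then show ?thesis using c'q by linarith
  qed
  have km: "stochastic_kmeans X k m\<^sub>o m (\<lambda>t r. \<eta> t) C" using assms(17) by (simp add: \<eta>_def)
  define K where "K = max (\<rho>\<^sup>2 * t\<^sub>o) (2 * c'\<^sup>2 * \<rho>\<^sup>2)"
  define K' where "K' = (\<Sum>r\<in>{1..k}. real (card (As r)) * K)"
  have K'0: "0 \<le> K'" unfolding K'_def K_def by (intro sum_nonneg) (simp add: le_max_iff_disj)
  have to1: "0 < c'" "c' \<le> t\<^sub>o" "1 < t\<^sub>o" using c'1 to by auto
  note bounds = nn_integral_centroidal_dist[OF sep st km \<eta>_def to1 hit K_def, folded K'_def]
  have G: "?G \<in> sets ?S" by (rule seeding_hits_measure)
  have "(1 - \<delta>) * (1 - \<xi>) \<le> 1 * (1 - \<xi>)" using True assms(9) by (intro mult_right_mono) auto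
  also have "\<dots> \<le> 1 - \<xi> / 2" using assms(3) by simp
  also have "\<dots> \<le> measure ?S ?G"
    by (rule seeding_hits_prob_ge[OF st assms(3,11)])
  finally have prob: "(1 - \<delta>) * (1 - \<xi>) \<le> measure ?S ?G" .
  have prob0: "0 < measure ?S ?G"
    using seeding_hits_prob_ge[OF st assms(3,11), of m] True by linarith
  have meas: "(\<lambda>\<omega>. C t \<omega> r) \<in> borel_measurable ?S" if "r \<in> {1..k}" for t r
    using km that unfolding stochastic_kmeans_def by blast
  have measD: "?D t \<in> borel_measurable ?S" for t by (intro borel_measurable_centroidal_dist meas)
  have measC: "(\<lambda>\<omega>. cost X k (C t \<omega>)) \<in> borel_measurable ?S" for t
    by (intro borel_measurable_cost meas)
  have "expectation_given ?S (\<lambda>\<omega>. cost X k (C t \<omega>)) ?G - cost X k Cs \<le> expectation_given ?S (?D t) ?G"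
    for t
  proof (rule expectation_given_diff_le[OF prob_space_sample_space G prob0 measC measD])
    have "k \<ge> 1" by (rule stationary_k_pos[OF st fin ne])
    then show "0 \<le> cost X k (C t \<omega>)" for \<omega> unfolding cost_def by (intro sum_nonneg) simp
    show "cost X k (C t \<omega>) \<le> cost X k Cs + ?D t \<omega>" for \<omega>
      by (rule cost_le_centroidal_dist[OF st fin])
    show "0 \<le> ?D t \<omega>" for \<omega> by (rule centroidal_dist_nonneg)
    show "?D t \<omega> \<le> (\<Sum>r\<in>{1..k}. real (card (As r)) * \<rho>\<^sup>2)" if "\<omega> \<in> ?G" for \<omega>
      by (rule bounds(2)[OF _ that])
  qed
  moreover have "expectation_given ?S (?D t) ?G \<le> K' / measure ?S ?G / real t" if t: "t \<ge> 1" for t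
  proof -
    have "expectation_given ?S (?D t) ?G \<le> K' / (real t + t\<^sub>o) / measure ?S ?G"
      using K'0 to1 by (intro expectation_given_le[OF G measD prob0 centroidal_dist_nonneg] bounds(1)) auto
    also have "\<dots> \<le> K' / real t / measure ?S ?G"
      using K'0 to1 t prob0 by (intro divide_right_mono divide_left_mono) auto
    finally show ?thesis by (simp add: mult.commute)
  qed
  ultimately show ?thesis using G prob by blast
qed

end
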